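(* Let $\mu$ be a self-similar measure of finite type (setting described in the context). If $x$ is a periodic point with period $\theta$, then the local dimension of $\mu$ at $x$ exists and is given by $$\dim_{loc}\mu(x)=\frac{\log \mathrm{sp}(T(\theta))}{L(\theta^-)\log\varrho},$$ where, if $x$ is a boundary point of a net interval with two different symbolic representations given by periods $\theta$ and $\phi$, then $\theta$ is chosen to satisfy $\mathrm{sp}(T(\theta))\ge \mathrm{sp}(T(\phi))$. Here $\mathrm{sp}$ denotes the spectral radius and $L(\theta^-)$ the number of letters of $\theta^-$.
   Context: Setting. Let $m\ge 1$ be an integer, $0<\varrho<1$, $0=d_0<d_1<\dots<d_m$, $S_j(x)=\varrho x+d_j$ for $j\in\mathcal A=\{0,\dots,m\}$. Let $K$ be the unique non-empty compact set with $K=\bigcup_j S_j(K)$; the $d_j$ are scaled so that the convex hull of $K$ is $[0,1]$ ($K$ need not be an interval). For $\sigma=(j_1,\dots,j_n)\in\mathcal A^n$ put $S_\sigma=S_{j_1}\circ\cdots\circ S_{j_n}$. The IFS is of finite type if there is a finite set $F\subseteq\mathbb R$ such that for every $n\ge1$ and all $\sigma,\sigma'\in\mathcal A^n$, either $\varrho^{-n}|S_\sigma(0)-S_{\sigma'}(0)|>1$ or $\varrho^{-n}(S_\sigma(0)-S_{\sigma'}(0))\in F$. Given $p_j>0$ with $\sum_j p_j=1$, $\mu$ is the unique Borel probability measure with $\mu=\sum_j p_j\,\mu\circ S_j^{-1}$; its support is $K$; $\mu$ is called of finite type if the IFS is. $\dim_{loc}\mu(x)=\lim_{r\to0^+}\frac{\log\mu([x-r,x+r])}{\log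 r}$ when the limit exists. Net intervals. Let $h_1<\dots<h_{s_n}$ be the elements of $\{S_\sigma(0),S_\sigma(1):\sigma\in\mathcal A^n\}$; $\mathcal F_n$ (net intervals of level $n$) is the set of $[h_j,h_{j+1}]$ with $(h_j,h_{j+1})\cap K\ne\emptyset$; $\mathcal F_0=\{[0,1]\}$. Each $\Delta\in\mathcal F_n$, $n\ge1$, is contained in a unique $\widehat\Delta\in\mathcal F_{n-1}$, its parent ($\Delta$ is a child of $\widehat\Delta$). For $\Delta=[a,b]\in\mathcal F_n$: normalized length $\ell_n(\Delta)=\varrho^{-n}(b-a)$; neighbour set $V_n(\Delta)$ = the ordered tuple of the distinct elements of $\{\varrho^{-n}(a-S_\sigma(0)):\sigma\in\mathcal A^n,\ \Delta\subseteq S_\sigma[0,1]\}$; $r_n(\Delta)$ = position of $\Delta$, from left to right, among the level $n$ net intervals with the same parent and the same normalized length. The characteristic vector is $\mathcal C_n(\Delta)=(\ell_n(\Delta),V_n(\Delta),r_n(\Delta))$. Under finite type there are finitely many characteristic vectors, and those of the children of $\Delta$ depend only on that of $\Delta$. An admissible path is a finite sequence of characteristic vectors, each being the parent of the next. A symbolic representation of $x\in K$ is a sequence $(\mathcal C_0(\Delta_0),\mathcal C_1(\Delta_1),\dots)$ with $x\in\Delta_n\in\mathcal F_n$ and $\Delta_n$ the parent of $\Delta_{n+1}$ for all $n$. $x$ is a boundary point if it is an endpoint of some net interval; a boundary point can have two symbolic representations (approaching $x$ from the left and from the right); all other points have exactly one. Transition matrices. For a level $n$ net interval $\Delta=[a,b]$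 with parent $\widehat\Delta=[c,d]$, $V_n(\Delta)=(a_1,\dots,a_N)$, $V_{n-1}(\widehat\Delta)=(c_1,\dots,c_M)$, the primitive transition matrix $T(\mathcal C_{n-1}(\widehat\Delta),\mathcal C_n(\Delta))$ is the $M\times N$ matrix whose $jk$ entry is $p_\ell$ if there are $\ell\in\mathcal A$ and $\sigma\in\mathcal A^{n-1}$ with $S_\sigma(0)=c-\varrho^{n-1}c_j$ and $S_{\sigma\ell}(0)=a-\varrho^n a_k$, and $0$ otherwise (it depends only on the two characteristic vectors). For an admissible path, $T(\gamma_1,\dots,\gamma_n)=T(\gamma_1,\gamma_2)\cdots T(\gamma_{n-1},\gamma_n)$. Periodic points. $x\in K$ is periodic if it has a symbolic representation $(\gamma_0,\dots,\gamma_J,\theta^-,\theta^-,\dots)$, where $\theta$ is an admissible cycle (a non-trivial admissible path with equal first and last letters) and $\theta^-$ is $\theta$ with its last letter deleted; $\theta$ is called a period of $x$. Boundary points are periodic. A period of a periodic point is not unique: for example, if $\theta$ is a period then so is $(\theta^-,\theta)$, giving the same symbolic representation.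
   Formalization: When x has two symbolic representations, the periods θ and φ are required to have the same number of letters; without this, comparing sp(T(θ)) with sp(T(φ)) can select the wrong period (repeating φ shrinks sp(T(φ))) and the formula fails. *)

theory Defs
  imports "HOL-Probability.Probability_Measure" "Jordan_Normal_Form.Spectral_Radius"
begin

definition sim :: "real \<Rightarrow> (nat \<Rightarrow> real) \<Rightarrow> nat \<Rightarrow> real \<Rightarrow> real" where
  "sim \<rho> d j x = \<rho> * x + d j"

text \<open>
  \<open>K\<close> is a parameter characterised by its defining properties; it is the unique non-empty compact
  set invariant under the IFS.  Only the values \<open>d j\<close> with \<open>j \<le> m\<close> matter.
\<close>
locale equicontractive_ifs =
  fixes m :: nat and \<rho> :: real and d :: "nat \<Rightarrow> real" and K :: "real set"
  assumes m_ge_1: "m \<ge> 1"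
    and rho_pos: "0 < \<rho>" and rho_less_1: "\<rho> < 1"
    and d_0: "d 0 = 0" and d_strict_mono: "strict_mono_on {0..m} d"
    and K_compact: "compact K" and K_nonempty: "K \<noteq> {}"
    and K_invariant: "K = (\<Union>j\<in>{0..m}. sim \<rho> d j ` K)"
    and hull_K: "convex hull K = {0..1}"

type_synonym net_interval = "real \<times> real"
  \<comment> \<open>the pair \<open>(a, b)\<close> stands for the interval \<open>{a..b}\<close>\<close>

type_synonym char_vec = "real \<times> real list \<times> nat"

definition ivl :: "net_interval \<Rightarrow> real set" where
  "ivl \<Delta> = {fst \<Delta>..snd \<Delta>}"

context equicontractive_ifs
begin

definition words :: "nat \<Rightarrow> nat list set" where
  "words n = {\<sigma>. length \<sigma> = n \<and> set \<sigma> \<subseteq> {0..m}}"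

definition S :: "nat list \<Rightarrow> real \<Rightarrow> real" where
  "S \<sigma> = foldr (sim \<rho> d) \<sigma>"

definition finite_type :: bool where
  "finite_type \<longleftrightarrow> (\<exists>F. finite F \<and> (\<forall>n\<ge>1. \<forall>\<sigma>\<in>words n. \<forall>\<sigma>'\<in>words n.
     \<bar>S \<sigma> 0 - S \<sigma>' 0\<bar> / \<rho> ^ n > 1 \<or> (S \<sigma> 0 - S \<sigma>' 0) / \<rho> ^ n \<in> F))"

definition endpoints :: "nat \<Rightarrow> real set" where
  "endpoints n = (\<lambda>\<sigma>. S \<sigma> 0) ` words n \<union> (\<lambda>\<sigma>. S \<sigma> 1) ` words n"

definition net_intervals :: "nat \<Rightarrow> net_interval set" where
  "net_intervals n =
     (if n = 0 then {(0, 1)}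
      else {(a, b). a \<in> endpoints n \<and> b \<in> endpoints n \<and> a < b \<and>
                    {a<..<b} \<inter> endpoints n = {} \<and> {a<..<b} \<inter> K \<noteq> {}})"

definition parent :: "nat \<Rightarrow> net_interval \<Rightarrow> net_interval \<Rightarrow> bool" where
  "parent n \<Delta>' \<Delta> \<longleftrightarrow>
     \<Delta>' \<in> net_intervals n \<and> \<Delta> \<in> net_intervals (Suc n) \<and> ivl \<Delta> \<subseteq> ivl \<Delta>'"

definition normalized_length :: "nat \<Rightarrow> net_interval \<Rightarrow> real" where
  "normalized_length n \<Delta> = (snd \<Delta> - fst \<Delta>) / \<rho> ^ n"

definition neighbour_set :: "nat \<Rightarrow> net_interval \<Rightarrow> real list" where
  "neighbour_set n \<Delta> = sorted_list_of_set
     {(fst \<Delta> - S \<sigma> 0) / \<rho> ^ n | \<sigma>. \<sigma> \<in> words n \<and> ivl \<Delta> \<subseteq> S \<sigma> ` {0..1}}"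

text \<open>Positions are counted from 1; the single net interval of level 0 has no parent and gets
  position 1.\<close>
definition position :: "nat \<Rightarrow> net_interval \<Rightarrow> nat" where
  "position n \<Delta> =
     (if n = 0 then 1
      else card {\<Delta>' \<in> net_intervals n.
                   (\<exists>\<Gamma>. parent (n - 1) \<Gamma> \<Delta> \<and> parent (n - 1) \<Gamma> \<Delta>') \<and>
                   normalized_length n \<Delta>' = normalized_length n \<Delta> \<and> fst \<Delta>' \<le> fst \<Delta>})"

definition char_vector :: "nat \<Rightarrow> net_interval \<Rightarrow> char_vec" where
  "char_vector n \<Delta> = (normalized_length n \<Delta>, neighbour_set n \<Delta>, position n \<Delta>)"

definition char_vectors :: "char_vec set" where
  "char_vectors = (\<Union>n. char_vector n ` net_intervals n)"

definition realizes_step ::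
    "char_vec \<Rightarrow> char_vec \<Rightarrow> nat \<times> net_interval \<times> net_interval \<Rightarrow> bool" where
  "realizes_step \<gamma> \<gamma>' = (\<lambda>(n, \<Delta>', \<Delta>).
     parent n \<Delta>' \<Delta> \<and> char_vector n \<Delta>' = \<gamma> \<and> char_vector (Suc n) \<Delta> = \<gamma>')"

definition parent_vec :: "char_vec \<Rightarrow> char_vec \<Rightarrow> bool" where
  "parent_vec \<gamma> \<gamma>' \<longleftrightarrow> (\<exists>w. realizes_step \<gamma> \<gamma>' w)"

definition admissible_path :: "char_vec list \<Rightarrow> bool" where
  "admissible_path \<gamma>s \<longleftrightarrow> \<gamma>s \<noteq> [] \<and> set \<gamma>s \<subseteq> char_vectors \<and> successively parent_vec \<gamma>s"

definition admissible_cycle :: "char_vec list \<Rightarrow> bool" where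
  "admissible_cycle \<theta> \<longleftrightarrow> admissible_path \<theta> \<and> length \<theta> \<ge> 2 \<and> hd \<theta> = last \<theta>"

definition symbolic_rep :: "real \<Rightarrow> (nat \<Rightarrow> char_vec) \<Rightarrow> bool" where
  "symbolic_rep x s \<longleftrightarrow> (\<exists>\<Delta>. \<forall>n. \<Delta> n \<in> net_intervals n \<and> x \<in> ivl (\<Delta> n) \<and>
     parent n (\<Delta> n) (\<Delta> (Suc n)) \<and> s n = char_vector n (\<Delta> n))"

text \<open>\<open>s = (\<gamma>\<^sub>0, \<dots>, \<gamma>\<^sub>J, \<theta>\<^sup>-, \<theta>\<^sup>-, \<dots>)\<close>, where \<open>\<theta>\<^sup>- = butlast \<theta>\<close>.\<close>
definition has_period :: "(nat \<Rightarrow> char_vec) \<Rightarrow> char_vec list \<Rightarrow> bool" where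
  "has_period s \<theta> \<longleftrightarrow> admissible_cycle \<theta> \<and>
     (\<exists>J. \<forall>n. s (Suc J + n) = butlast \<theta> ! (n mod length (butlast \<theta>)))"

definition boundary_point :: "real \<Rightarrow> bool" where
  "boundary_point x \<longleftrightarrow> (\<exists>n. \<exists>\<Delta>\<in>net_intervals n. x = fst \<Delta> \<or> x = snd \<Delta>)"

text \<open>\<open>\<Delta>'\<close> has level \<open>n\<close> and its child \<open>\<Delta>\<close> has level \<open>Suc n\<close>.  The letter \<open>l\<close> below is unique when
  it exists, as \<open>d\<close> is injective on the alphabet and \<open>S \<sigma> 0\<close>, \<open>S (\<sigma> @ [l]) 0\<close> are prescribed.\<close>
definition interval_transition ::
    "(nat \<Rightarrow> real) \<Rightarrow> nat \<Rightarrow> net_interval \<Rightarrow> net_interval \<Rightarrow> real mat" where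
  "interval_transition p n \<Delta>' \<Delta> =
     (let cs = neighbour_set n \<Delta>'; as = neighbour_set (Suc n) \<Delta>;
          Q = (\<lambda>j k l. l \<in> {0..m} \<and> (\<exists>\<sigma>\<in>words n.
                 S \<sigma> 0 = fst \<Delta>' - \<rho> ^ n * cs ! j \<and>
                 S (\<sigma> @ [l]) 0 = fst \<Delta> - \<rho> ^ Suc n * as ! k))
      in mat (length cs) (length as)
           (\<lambda>(j, k). if \<exists>l. Q j k l then p (THE l. Q j k l) else 0))"

text \<open>The primitive transition matrix of a pair of characteristic vectors, computed from any
  parent and child realizing that pair.\<close>
definition primitive_transition :: "(nat \<Rightarrow> real) \<Rightarrow> char_vec \<Rightarrow> char_vec \<Rightarrow> real mat" where
  "primitive_transition p \<gamma> \<gamma>' =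
     (case (SOME w. realizes_step \<gamma> \<gamma>' w) of (n, \<Delta>', \<Delta>) \<Rightarrow> interval_transition p n \<Delta>' \<Delta>)"

text \<open>On one-letter paths the empty product is the identity matrix whose size is the number of
  neighbours.\<close>
fun transition :: "(nat \<Rightarrow> real) \<Rightarrow> char_vec list \<Rightarrow> real mat" where
  "transition p [] = 1\<^sub>m 0"
| "transition p [\<gamma>] = 1\<^sub>m (length (fst (snd \<gamma>)))"
| "transition p (\<gamma> # \<gamma>' # \<gamma>s) = primitive_transition p \<gamma> \<gamma>' * transition p (\<gamma>' # \<gamma>s)"

end

locale self_similar_measure = equicontractive_ifs m \<rho> d K
  for m :: nat and \<rho> :: real and d :: "nat \<Rightarrow> real" and K :: "real set" +
  fixes p :: "nat \<Rightarrow> real" and \<mu> :: "real measure"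
  assumes p_pos: "\<And>j. j \<in> {0..m} \<Longrightarrow> p j > 0"
    and p_sum: "(\<Sum>j\<in>{0..m}. p j) = 1"
    and mu_prob: "prob_space \<mu>"
    and sets_mu: "sets \<mu> = sets borel"
    and mu_self_similar: "\<And>A. A \<in> sets borel \<Longrightarrow>
          measure \<mu> A = (\<Sum>j\<in>{0..m}. p j * measure \<mu> (sim \<rho> d j -` A))"

definition sp :: "real mat \<Rightarrow> real" where
  "sp A = spectral_radius (map_mat complex_of_real A)"

text \<open>The local dimension of \<open>\<mu>\<close> at \<open>x\<close> exists and equals \<open>\<delta>\<close>.\<close>
definition has_local_dim :: "real measure \<Rightarrow> real \<Rightarrow> real \<Rightarrow> bool" where
  "has_local_dim \<mu> x \<delta> \<longleftrightarrow>
     ((\<lambda>r. ln (measure \<mu> {x - r..x + r}) / ln r) \<longlongrightarrow> \<delta>) (at_right 0)"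

end

theory Submission
  imports Defs
begin

text \<open>
  Write \<open>R = \<rho> ^ L\<close> for the contraction over one period \<open>\<theta>\<close>.  The position of a child inside its
  parent is determined by their characteristic vectors, so along a periodic representation the net
  intervals satisfy \<open>\<Delta> (N + k * L) = x + R ^ k * (\<Delta> N - x)\<close>.  The row vector of the total
  probabilities of the words giving each neighbour of \<open>\<Delta> n\<close> is multiplied by the transition matrix
  when passing to \<open>\<Delta> (Suc n)\<close>; it has positive entries, so its sum \<open>W\<close> grows over periods like
  the powers of \<open>sp (T \<theta>)\<close>.

  Every \<open>S \<sigma> ` {0..1}\<close> containing \<open>\<Delta> n\<close> lies in the ball of radius \<open>\<rho> ^ n\<close> about \<open>x\<close>, hence
  \<open>\<mu>\<close> of this ball is at least \<open>W\<close>.  For an upper bound consider each side of \<open>x\<close>: if \<open>K\<close>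
  accumulates at \<open>x\<close> from that side, there is a representation whose net intervals contain a one-sided
  neighbourhood of \<open>x\<close> of size comparable to \<open>\<rho> ^ n\<close>, and \<open>\<mu>\<close> of a net interval is at most its
  \<open>W\<close>; otherwise that side is null near \<open>x\<close>.  The lower bound does not require the neighbours to
  carry mass inside \<open>\<Delta> n\<close>, which can fail when \<open>K\<close> has gaps.
\<close>

section \<open>Growth of matrix powers\<close>

lemma power_le_iff_le_log:
  fixes R y :: real
  assumes "0 < R" "R < 1" "0 < y"
  shows "R ^ k \<le> y \<longleftrightarrow> ln y / ln R \<le> real k"
proof -
  have "R ^ k \<le> y \<longleftrightarrow> ln (R ^ k) \<le> ln y"
    using assms by (intro ln_le_cancel_iff[symmetric]) auto
  also have "\<dots> \<longleftrightarrow> ln y / ln R \<le> real k"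
    using assms by (simp add: ln_realpow neg_divide_le_eq)
  finally show ?thesis .
qed

text \<open>Since \<open>ln (r / A) = ln r - ln A\<close>, the quotient is \<open>b / ln R\<close>
  plus a constant over \<open>ln r\<close>, and \<open>ln r\<close> tends to minus infinity at
  0.\<close>

lemma log_ratio_tendsto:
  fixes a b A R :: real
  assumes "0 < A" "0 < R" "R < 1"
  shows "((\<lambda>r. (a + ln (r / A) / ln R * b) / ln r) \<longlongrightarrow> b / ln R) (at_right 0)"
proof -
  have lim: "((\<lambda>r. (a - ln A * b / ln R) / ln r + b / ln R) \<longlongrightarrow> 0 + b / ln R) (at_right 0)"
    by (intro tendsto_add tendsto_const tendsto_divide_0[OF tendsto_const]
        filterlim_at_bot_imp_at_infinity ln_at_0)
  have "\<forall>\<^sub>F r :: real in at_right 0. r < 1"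
    by (rule eventually_at_right_less[of 0, THEN eventually_rev_mp])
      (auto simp: eventually_at_right_field intro: exI[of _ 1])
  then have "\<forall>\<^sub>F r in at_right 0.
      (a - ln A * b / ln R) / ln r + b / ln R = (a + ln (r / A) / ln R * b) / ln r"
    using eventually_at_right_less[of "0::real"]
  proof eventually_elim
    case (elim r)
    then have "ln r \<noteq> 0" "ln R \<noteq> 0" using assms by auto
    then show ?case using elim assms by (simp add: ln_div field_simps)
  qed
  from Lim_transform_eventually[OF lim this] show ?thesis by simp
qed

text \<open>Replacing \<open>r\<close> by a neighbouring scale alters the bounds on
  \<open>ln (f r)\<close> by a bounded amount, which vanishes after division by \<open>ln r\<close>.
  The upper bound is available at every rate above \<open>s\<close>; continuity of \<open>ln\<close>
  removes this loss.\<close>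

lemma geometric_bounds_imp_log_ratio_tendsto:
  fixes f :: "real \<Rightarrow> real"
  assumes mono: "\<And>r r'. 0 < r \<Longrightarrow> r \<le> r' \<Longrightarrow> f r \<le> f r'"
    and R: "0 < R" "R < 1" and s: "0 < s" and A: "0 < A" and c: "0 < c"
    and low: "\<And>k. c * s ^ k \<le> f (A * R ^ k)"
    and up: "\<And>t. s < t \<Longrightarrow> \<exists>B>0. \<exists>C>0. \<forall>k. f (B * R ^ k) \<le> C * t ^ k"
  shows "((\<lambda>r. ln (f r) / ln r) \<longlongrightarrow> ln s / ln R) (at_right 0)"
proof -
  have lnR: "ln R < 0" using R by simp
  have pos_small: "\<forall>\<^sub>F r :: real in at_right 0. 0 < r \<and> r < M" if "0 < M" for M
    using that by (auto simp: eventually_at_right_field)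
  have fpos: "0 < f r \<and> ln c + ln (r / A) / ln R * ln s - \<bar>ln s\<bar> \<le> ln (f r)"
    if r: "0 < r" "r < A" for r
  proof -
    define y where "y = ln (r / A) / ln R"
    have y: "0 \<le> y" unfolding y_def using r A lnR by (intro divide_nonpos_nonpos) auto
    \<comment> \<open>Rounding up selects the scale \<open>A * R ^ k\<close> just below
      \<open>r\<close>, where the lower bound applies.\<close>
    define k where "k = nat \<lceil>y\<rceil>"
    have k: "y \<le> real k" "real k \<le> y + 1" using y unfolding k_def by linarith+
    have "R ^ k \<le> r / A"
      using power_le_iff_le_log[OF R, of "r / A" k] r A k by (simp add: y_def)
    then have le: "A * R ^ k \<le> r" using A by (simp add: field_simps)
    have "c * s ^ k \<le> f r" using low[of k] mono[OF _ le] A R by (simp add: order_trans)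
    moreover have cs: "0 < c * s ^ k" using c s by simp
    ultimately have pos: "0 < f r" and "ln (c * s ^ k) \<le> ln (f r)" by auto
    then have *: "ln c + real k * ln s \<le> ln (f r)"
      using c s by (simp add: ln_mult ln_realpow)
    have "\<bar>(real k - y) * ln s\<bar> \<le> 1 * \<bar>ln s\<bar>"
      unfolding abs_mult by (rule mult_right_mono) (use k in auto)
    then have "y * ln s - \<bar>ln s\<bar> \<le> real k * ln s"
      by (simp add: left_diff_distrib)
    with * pos show ?thesis unfolding y_def by linarith
  qed
  \<comment> \<open>The condition \<open>r < A\<close> serves \<open>fpos\<close>: it makes
    \<open>f r\<close> positive, so that \<open>ln\<close> is monotone there.\<close>
  have fup: "\<exists>B>0. \<exists>a. \<forall>r. 0 < r \<and> r < B \<and> r < A \<longrightarrow> ln (f r) \<le> a + ln (r / B) / ln R * ln t"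
    if t: "s < t" for t
  proof -
    obtain B C where B: "B > 0" and C: "C > 0" and up': "\<And>k. f (B * R ^ k) \<le> C * t ^ k"
      using up[OF t] by blast
    have "ln (f r) \<le> (ln C + \<bar>ln t\<bar>) + ln (r / B) / ln R * ln t"
      if r: "0 < r" "r < B" "r < A" for r
    proof -
      define y where "y = ln (r / B) / ln R"
      have y: "0 \<le> y" unfolding y_def using r B lnR by (intro divide_nonpos_nonpos) auto
      \<comment> \<open>Rounding down selects the scale \<open>B * R ^ k\<close> just above
        \<open>r\<close>, where the upper bound applies.\<close>
      define k where "k = nat \<lfloor>y\<rfloor>"
      have k: "real k \<le> y" "y \<le> real k + 1" using y unfolding k_def by linarith+
      have "r / B \<le> R ^ k"
      proof -
        have "ln (r / B) \<le> ln (R ^ k)"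
          using k(1) lnR R by (simp add: y_def ln_realpow neg_le_divide_eq)
        then show ?thesis using r B R by (subst (asm) ln_le_cancel_iff) auto
      qed
      then have le: "r \<le> B * R ^ k" using B by (simp add: field_simps)
      have "f r \<le> C * t ^ k" using mono[OF r(1) le] up'[of k] by simp
      moreover have "0 < f r" using fpos[OF r(1) r(3)] by blast
      ultimately have "ln (f r) \<le> ln (C * t ^ k)" by simp
      then have *: "ln (f r) \<le> ln C + real k * ln t"
        using C s t by (simp add: ln_mult ln_realpow)
      have "\<bar>(real k - y) * ln t\<bar> \<le> 1 * \<bar>ln t\<bar>"
        unfolding abs_mult by (rule mult_right_mono) (use k in auto)
      then have "real k * ln t \<le> y * ln t + \<bar>ln t\<bar>"
        by (simp add: left_diff_distrib)
      with * show ?thesis unfolding y_def by linarith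
    qed
    with B show ?thesis by blast
  qed
  show ?thesis
  proof (rule order_tendstoI)
    \<comment> \<open>As \<open>ln r < 0\<close>, lower bounds on \<open>f\<close> bound the ratio
      from above, and upper bounds on \<open>f\<close> bound it from below.\<close>
    fix u assume u: "ln s / ln R < u"
    have "\<forall>\<^sub>F r in at_right 0. ((ln c - \<bar>ln s\<bar>) + ln (r / A) / ln R * ln s) / ln r < u"
      using log_ratio_tendsto[OF A R] u by (rule order_tendstoD)
    moreover have "\<forall>\<^sub>F r in at_right 0. 0 < r \<and> r < min A 1"
      using A by (intro pos_small) auto
    ultimately show "\<forall>\<^sub>F r in at_right 0. ln (f r) / ln r < u"
    proof eventually_elim
      case (elim r)
      then have "ln r < 0" by simp
      have "(ln c - \<bar>ln s\<bar>) + ln (r / A) / ln R * ln s \<le> ln (f r)"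
        using fpos[of r] elim by simp
      then have "ln (f r) / ln r \<le> ((ln c - \<bar>ln s\<bar>) + ln (r / A) / ln R * ln s) / ln r"
        using \<open>ln r < 0\<close> by (intro divide_right_mono_neg) auto
      with elim show ?case by linarith
    qed
  next
    fix l assume l: "l < ln s / ln R"
    \<comment> \<open>A rate \<open>t\<close> above \<open>s\<close> is chosen so close to
      \<open>s\<close> that \<open>ln t / ln R\<close> still exceeds \<open>l\<close>.\<close>
    have "((\<lambda>t. ln t / ln R) \<longlongrightarrow> ln s / ln R) (at_right s)"
      using s lnR by (intro tendsto_intros) auto
    then have "\<forall>\<^sub>F t in at_right s. l < ln t / ln R" using l by (rule order_tendstoD)
    moreover have "\<forall>\<^sub>F t in at_right s. s < t" by (rule eventually_at_right_less)
    ultimately have "\<forall>\<^sub>F t in at_right s. s < t \<and> l < ln t / ln R" by eventually_elim simp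
    then obtain t where t: "s < t" "l < ln t / ln R"
      using eventually_happens'[of "at_right s"] by (auto simp: trivial_limit_at_right_real)
    obtain B a where B: "B > 0" and
      a: "\<And>r. 0 < r \<Longrightarrow> r < B \<Longrightarrow> r < A \<Longrightarrow> ln (f r) \<le> a + ln (r / B) / ln R * ln t"
      using fup[OF t(1)] by blast
    have "\<forall>\<^sub>F r in at_right 0. l < (a + ln (r / B) / ln R * ln t) / ln r"
      using log_ratio_tendsto[OF B R] t(2) by (rule order_tendstoD)
    moreover have "\<forall>\<^sub>F r in at_right 0. 0 < r \<and> r < min (min A B) 1"
      using A B by (intro pos_small) auto
    ultimately show "\<forall>\<^sub>F r in at_right 0. l < ln (f r) / ln r"
    proof eventually_elim
      case (elim r)
      then have "ln r < 0" by simp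
      have "(a + ln (r / B) / ln R * ln t) / ln r \<le> ln (f r) / ln r"
        using \<open>ln r < 0\<close> a[of r] elim by (intro divide_right_mono_neg) auto
      with elim show ?case by linarith
    qed
  qed
qed

section \<open>Matrix powers and the spectral radius\<close>

lemma smult_pow_mat:
  fixes A :: "'a :: comm_ring_1 mat"
  assumes "A \<in> carrier_mat n n"
  shows "(a \<cdot>\<^sub>m A) ^\<^sub>m k = a ^ k \<cdot>\<^sub>m (A ^\<^sub>m k)"
proof (induction k)
  case (Suc k)
  have "A ^\<^sub>m k \<in> carrier_mat n n" using assms by simp
  then show ?case
    using assms by (intro eq_matI) (auto simp: Suc scalar_prod_def sum_distrib_left ac_simps)
qed (use assms in auto)

lemma sp_nonneg:
  assumes "A \<in> carrier_mat n n" "0 < n"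
  shows "0 \<le> sp A"
proof -
  have "map_mat complex_of_real A \<in> carrier_mat n n" using assms by simp
  from spectral_radius_mem_max(1)[OF this assms(2)] show ?thesis
    unfolding sp_def by force
qed

text \<open>Divided by \<open>t\<close>, the matrix has spectral radius below 1, and its Jordan
  normal form then bounds the entries of all its powers by one constant.\<close>

lemma pow_mat_entries_le_sp_power:
  assumes A: "A \<in> carrier_mat n n" and n: "0 < n" and t: "sp A < t"
  obtains C where "0 < C" "\<And>k i j. i < n \<Longrightarrow> j < n \<Longrightarrow> \<bar>(A ^\<^sub>m k) $$ (i, j)\<bar> \<le> C * t ^ k"
proof -
  have t0: "0 < t" using sp_nonneg[OF A n] t by simp
  define M where "M = map_mat complex_of_real A"
  define N where "N = complex_of_real (1 / t) \<cdot>\<^sub>m M"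
  have M: "M \<in> carrier_mat n n" and N: "N \<in> carrier_mat n n"
    using A by (auto simp: M_def N_def)
  \<comment> \<open>An eigenvalue of \<open>N\<close> of maximal modulus, multiplied by
    \<open>t\<close>, is an eigenvalue of \<open>M\<close> with the same eigenvector.\<close>
  have "spectral_radius N < 1"
  proof -
    obtain ev where ev: "ev \<in> spectrum N" "spectral_radius N = norm ev"
      using spectral_radius_mem_max(1)[OF N n] by auto
    then obtain v where v: "v \<in> carrier_vec n" "v \<noteq> 0\<^sub>v n" "N *\<^sub>v v = ev \<cdot>\<^sub>v v"
      using N by (auto simp: spectrum_def eigenvalue_def eigenvector_def)
    have "M *\<^sub>v v = (complex_of_real t * ev) \<cdot>\<^sub>v v"
    proof -
      have "M = complex_of_real t \<cdot>\<^sub>m N"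
        using t0 M by (intro eq_matI) (auto simp: N_def)
      moreover have "(complex_of_real t \<cdot>\<^sub>m N) *\<^sub>v v = complex_of_real t \<cdot>\<^sub>v (N *\<^sub>v v)"
        using N v(1) by (intro eq_vecI) (auto simp: scalar_prod_def sum_distrib_left ac_simps)
      ultimately show ?thesis using v by (simp add: smult_smult_assoc)
    qed
    then have "complex_of_real t * ev \<in> spectrum M"
      using v M by (auto simp: spectrum_def eigenvalue_def eigenvector_def)
    then have "norm (complex_of_real t * ev) \<le> spectral_radius M"
      by (intro spectral_radius_mem_max(2)[OF M n]) auto
    then have "t * norm ev \<le> spectral_radius M" using t0 by (simp add: norm_mult)
    then have "t * norm ev < t" using t unfolding sp_def M_def by linarith
    then show ?thesis using t0 ev by simp
  qed
  then obtain c where c: "\<And>k. norm_bound (N ^\<^sub>m k) c"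
    using spectral_radius_jnf_norm_bound_less_1_upper_triangular[OF N] by blast
  \<comment> \<open>The maximum with 1 supplies the positivity of the constant.\<close>
  show thesis
  proof (rule that[of "max c 1"])
    fix k i j assume ij: "i < n" "j < n"
    have "N ^\<^sub>m k = complex_of_real (1 / t) ^ k \<cdot>\<^sub>m map_mat complex_of_real (A ^\<^sub>m k)"
      unfolding N_def smult_pow_mat[OF M] unfolding M_def of_real_hom.mat_hom_pow[OF A] ..
    then have "(N ^\<^sub>m k) $$ (i, j) = complex_of_real ((A ^\<^sub>m k) $$ (i, j) / t ^ k)"
      using ij A pow_carrier_mat[OF A, of k] by (simp add: power_divide)
    then have "norm ((N ^\<^sub>m k) $$ (i, j)) = \<bar>(A ^\<^sub>m k) $$ (i, j)\<bar> / t ^ k"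
      using t0 by (simp only: norm_of_real abs_divide) simp
    moreover have "norm ((N ^\<^sub>m k) $$ (i, j)) \<le> c"
      using c[of k] ij N unfolding norm_bound_def by simp
    ultimately have "\<bar>(A ^\<^sub>m k) $$ (i, j)\<bar> \<le> c * t ^ k"
      using t0 by (simp add: divide_le_eq)
    also have "\<dots> \<le> max c 1 * t ^ k" using t0 by (intro mult_right_mono) auto
    finally show "\<bar>(A ^\<^sub>m k) $$ (i, j)\<bar> \<le> max c 1 * t ^ k" .
  qed simp
qed

text \<open>Let \<open>v\<close> be an eigenvector for an eigenvalue of largest modulus and
  \<open>i\<close> a coordinate where \<open>v\<close> is nonzero. The power \<open>k\<close>
  multiplies this coordinate by a number of modulus \<open>sp A ^ k\<close>, and the result is at
  most the row sum times a bound on the coordinates of \<open>v\<close>. The row is the same for all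
  \<open>k\<close>.\<close>

lemma sp_power_le_pow_mat_row_sum:
  assumes A: "A \<in> carrier_mat n n" and n: "0 < n"
  obtains c i where "0 < c" "i < n" "\<And>k. c * sp A ^ k \<le> (\<Sum>j<n. \<bar>(A ^\<^sub>m k) $$ (i, j)\<bar>)"
proof -
  define M where "M = map_mat complex_of_real A"
  have M: "M \<in> carrier_mat n n" using A by (auto simp: M_def)
  obtain ev where ev: "ev \<in> spectrum M" "sp A = norm ev"
    using spectral_radius_mem_max(1)[OF M n] by (auto simp: sp_def M_def)
  then obtain v where v: "v \<in> carrier_vec n" "v \<noteq> 0\<^sub>v n" "eigenvector M v ev"
    using M by (auto simp: spectrum_def eigenvalue_def eigenvector_def)
  obtain i where i: "i < n" "vec_index v i \<noteq> 0"
    using v(1,2) by (metis carrier_vecD eq_vecI index_zero_vec)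
  define b where "b = (\<Sum>j<n. norm (vec_index v j))"
  have le_b: "norm (vec_index v j) \<le> b" if "j < n" for j
    unfolding b_def using that by (intro member_le_sum) auto
  have b: "0 < b" using le_b[OF i(1)] i(2) by (smt (verit) zero_less_norm_iff)
  show thesis
  proof (rule that[of "norm (vec_index v i) / b" i])
    fix k
    have "ev ^ k * vec_index v i = vec_index (M ^\<^sub>m k *\<^sub>v v) i"
      using eigenvector_pow[OF M v(3), of k] v i by simp
    also have "M ^\<^sub>m k = map_mat complex_of_real (A ^\<^sub>m k)"
      unfolding M_def of_real_hom.mat_hom_pow[OF A] ..
    also have "vec_index (\<dots> *\<^sub>v v) i =
        (\<Sum>j<n. complex_of_real ((A ^\<^sub>m k) $$ (i, j)) * vec_index v j)"
      using i v A by (simp add: scalar_prod_def lessThan_atLeast0)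
    finally have "norm ev ^ k * norm (vec_index v i) =
        norm (\<Sum>j<n. complex_of_real ((A ^\<^sub>m k) $$ (i, j)) * vec_index v j)"
      by (metis norm_mult norm_power)
    also have "\<dots> \<le> (\<Sum>j<n. \<bar>(A ^\<^sub>m k) $$ (i, j)\<bar> * b)"
      by (intro sum_norm_le) (auto simp: norm_mult intro!: mult_left_mono le_b)
    finally show "norm (vec_index v i) / b * sp A ^ k \<le> (\<Sum>j<n. \<bar>(A ^\<^sub>m k) $$ (i, j)\<bar>)"
      using b by (simp add: ev sum_distrib_left[symmetric] divide_le_eq mult.commute)
  qed (use i b in auto)
qed

lemma pow_mat_nonneg:
  fixes A :: "real mat"
  assumes A: "A \<in> carrier_mat n n" and nn: "\<And>i j. i < n \<Longrightarrow> j < n \<Longrightarrow> 0 \<le> A $$ (i, j)"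
  shows "i < n \<Longrightarrow> j < n \<Longrightarrow> 0 \<le> (A ^\<^sub>m k) $$ (i, j)"
proof (induction k arbitrary: i j)
  case (Suc k)
  then show ?case
    using A pow_carrier_mat[OF A, of k]
    by (auto simp: scalar_prod_def intro!: sum_nonneg mult_nonneg_nonneg nn)
qed (use A in auto)

section \<open>Net intervals and their children\<close>

context equicontractive_ifs
begin

section \<open>Words, their affine maps and the attractor\<close>

lemma rho_power_pos: "0 < \<rho> ^ n"
  using rho_pos by simp

lemma rho_nonzero [simp]: "\<rho> \<noteq> 0"
  using rho_pos by simp

lemma finite_words: "finite (words n)"
  using finite_lists_length_eq[of "{0..m}" n] by (simp add: words_def conj_commute)

lemma words_Suc: "words (Suc n) = (\<lambda>(\<sigma>, l). \<sigma> @ [l]) ` (words n \<times> {0..m})"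
proof (intro equalityI subsetI)
  fix \<tau> assume \<tau>: "\<tau> \<in> words (Suc n)"
  then have "\<tau> = butlast \<tau> @ [last \<tau>]"
    by (cases \<tau> rule: rev_cases) (auto simp: words_def)
  moreover have "butlast \<tau> \<in> words n" "last \<tau> \<in> {0..m}"
    using \<tau> by (cases \<tau> rule: rev_cases; auto simp: words_def)+
  ultimately show "\<tau> \<in> (\<lambda>(\<sigma>, l). \<sigma> @ [l]) ` (words n \<times> {0..m})" by force
qed (auto simp: words_def)

lemma words_SucE:
  assumes "\<tau> \<in> words (Suc n)"
  obtains \<sigma> l where "\<tau> = \<sigma> @ [l]" "\<sigma> \<in> words n" "l \<in> {0..m}"
  using assms by (auto simp: words_Suc)

lemma words_snoc: "\<sigma> \<in> words n \<Longrightarrow> l \<in> {0..m} \<Longrightarrow> \<sigma> @ [l] \<in> words (Suc n)"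
  by (auto simp: words_Suc)

lemma S_affine: "\<sigma> \<in> words n \<Longrightarrow> S \<sigma> x = S \<sigma> 0 + \<rho> ^ n * x"
  by (induction \<sigma> arbitrary: n) (auto simp: words_def S_def sim_def algebra_simps)

lemma S_snoc: "\<sigma> \<in> words n \<Longrightarrow> S (\<sigma> @ [l]) x = S \<sigma> 0 + \<rho> ^ n * (\<rho> * x + d l)"
  using S_affine[of \<sigma> n "\<rho> * x + d l"] by (simp add: S_def sim_def)

lemma d_inj: "l \<in> {0..m} \<Longrightarrow> l' \<in> {0..m} \<Longrightarrow> d l = d l' \<Longrightarrow> l = l'"
  using d_strict_mono strict_mono_on_imp_inj_on by (blast dest: inj_onD)

lemma d_le: "l \<in> {0..m} \<Longrightarrow> d l \<le> d m"
  using strict_mono_on_leD[OF d_strict_mono, of l m] by auto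

lemma d_nonneg: "l \<in> {0..m} \<Longrightarrow> 0 \<le> d l"
  using strict_mono_on_leD[OF d_strict_mono, of 0 l] d_0 by auto

lemma d_pos: "l \<in> {0..m} \<Longrightarrow> l \<noteq> 0 \<Longrightarrow> 0 < d l"
  using strict_mono_onD[OF d_strict_mono, of 0 l] d_0 by auto

lemma K_subset: "K \<subseteq> {0..1}"
  using hull_subset[of K convex] hull_K by simp

text \<open>The least and the greatest point of \<open>K\<close> bound an interval that contains the
  hull, so they must be 0 and 1.\<close>

lemma zero_in_K: "0 \<in> K" and one_in_K: "1 \<in> K"
proof -
  obtain a b where a: "a \<in> K" "\<And>y. y \<in> K \<Longrightarrow> a \<le> y" and b: "b \<in> K" "\<And>y. y \<in> K \<Longrightarrow> y \<le> b"
    using compact_attains_inf[OF K_compact K_nonempty] compact_attains_sup[OF K_compact K_nonempty]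
    by blast
  have "convex hull K \<subseteq> {a..b}"
    by (rule hull_minimal) (use a b in auto)
  then have "a \<le> 0" "1 \<le> b" unfolding hull_K by auto
  moreover have "0 \<le> a" "b \<le> 1" using a b K_subset by auto
  ultimately show "0 \<in> K" "1 \<in> K" using a b by (metis order_antisym)+
qed

lemma sim_in_K: "l \<in> {0..m} \<Longrightarrow> y \<in> K \<Longrightarrow> \<rho> * y + d l \<in> K"
  by (subst K_invariant) (auto simp: sim_def)

lemma K_simE:
  assumes "y \<in> K"
  obtains l z where "l \<in> {0..m}" "z \<in> K" "y = \<rho> * z + d l"
  using assms by (subst (asm) K_invariant) (auto simp: sim_def)

text \<open>This says that the last map fixes 1: the image of 1 lies in \<open>K\<close>, hence is
  at most 1, while 1 is itself an image of a point of \<open>K\<close> and every such image is at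
  most \<open>\<rho> + d m\<close>.\<close>

lemma d_top: "\<rho> + d m = 1"
proof -
  have "\<rho> + d m \<in> K" using sim_in_K[of m 1] one_in_K by simp
  then have "\<rho> + d m \<le> 1" using K_subset by auto
  moreover obtain l z where l: "l \<in> {0..m}" "z \<in> K" "1 = \<rho> * z + d l"
    using one_in_K by (rule K_simE)
  have "\<rho> * z \<le> \<rho> * 1" using l K_subset rho_pos by (intro mult_left_mono) auto
  then have "1 \<le> \<rho> + d m" using l d_le[OF l(1)] by simp
  ultimately show ?thesis by simp
qed

lemma S_image_unit: "\<sigma> \<in> words n \<Longrightarrow> S \<sigma> ` {0..1} = {S \<sigma> 0..S \<sigma> 0 + \<rho> ^ n}"
proof -
  assume \<sigma>: "\<sigma> \<in> words n"
  have "S \<sigma> ` {0..1} = (\<lambda>x. \<rho> ^ n * x + S \<sigma> 0) ` {0..1}"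
    by (intro image_cong refl, subst S_affine[OF \<sigma>]) simp
  also have "\<dots> = {S \<sigma> 0..S \<sigma> 0 + \<rho> ^ n}"
    using rho_power_pos[of n] image_affinity_atLeastAtMost[of "\<rho> ^ n" "S \<sigma> 0" 0 1]
    by (simp add: add.commute)
  finally show ?thesis .
qed

lemma S_in_K: "\<sigma> \<in> words n \<Longrightarrow> y \<in> K \<Longrightarrow> S \<sigma> y \<in> K"
  by (induction \<sigma> arbitrary: n) (auto simp: words_def S_def sim_def intro!: sim_in_K)

lemma K_wordE:
  assumes "y \<in> K"
  obtains \<sigma> z where "\<sigma> \<in> words n" "z \<in> K" "y = S \<sigma> z"
  using assms
proof (induction n arbitrary: y thesis)
  case 0
  from 0(1)[of "[]" y] 0(2) show ?case by (auto simp: words_def S_def)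
next
  case (Suc n)
  obtain \<sigma> z where \<sigma>: "\<sigma> \<in> words n" "z \<in> K" "y = S \<sigma> z" using Suc.IH Suc.prems(2) by blast
  obtain l z' where l: "l \<in> {0..m}" "z' \<in> K" "z = \<rho> * z' + d l"
    using \<sigma>(2) by (rule K_simE)
  have "y = S (\<sigma> @ [l]) z'" using \<sigma> l by (simp add: S_def sim_def)
  then show ?case using Suc.prems(1) words_snoc \<sigma> l by blast
qed

section \<open>Endpoints, net intervals and parents\<close>

lemma finite_endpoints: "finite (endpoints n)"
  unfolding endpoints_def using finite_words by simp

lemma endpoints_iff:
  "y \<in> endpoints n \<longleftrightarrow> (\<exists>\<sigma>\<in>words n. y = S \<sigma> 0 \<or> y = S \<sigma> 0 + \<rho> ^ n)"
  unfolding endpoints_def using S_affine[of _ n 1] by auto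

lemma endpoints_Suc_iff:
  "y \<in> endpoints (Suc n) \<longleftrightarrow>
    (\<exists>\<sigma>\<in>words n. \<exists>l\<in>{0..m}. y = S \<sigma> 0 + \<rho> ^ n * d l \<or> y = S \<sigma> 0 + \<rho> ^ n * (d l + \<rho>))"
proof -
  have "y \<in> endpoints (Suc n) \<longleftrightarrow>
      (\<exists>\<sigma>\<in>words n. \<exists>l\<in>{0..m}. y = S (\<sigma> @ [l]) 0 \<or> y = S (\<sigma> @ [l]) 0 + \<rho> ^ Suc n)"
    unfolding endpoints_iff by (auto simp: words_Suc)
  also have "\<dots> \<longleftrightarrow>
      (\<exists>\<sigma>\<in>words n. \<exists>l\<in>{0..m}. y = S \<sigma> 0 + \<rho> ^ n * d l \<or> y = S \<sigma> 0 + \<rho> ^ n * (d l + \<rho>))"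
    by (intro bex_cong refl) (simp add: S_snoc algebra_simps)
  finally show ?thesis .
qed

text \<open>A left end reappears through the letter 0, as \<open>d 0 = 0\<close>, and a right end
  through the letter \<open>m\<close>, as \<open>d m + \<rho> = 1\<close>.\<close>

lemma endpoints_subset_Suc: "endpoints n \<subseteq> endpoints (Suc n)"
proof
  fix y assume "y \<in> endpoints n"
  then obtain \<sigma> where \<sigma>: "\<sigma> \<in> words n" "y = S \<sigma> 0 \<or> y = S \<sigma> 0 + \<rho> ^ n"
    by (auto simp: endpoints_iff)
  have "d m + \<rho> = 1" using d_top by simp
  then show "y \<in> endpoints (Suc n)"
    unfolding endpoints_Suc_iff using \<sigma> d_0
    by (intro bexI[of _ \<sigma>]) (metis atLeastAtMost_iff le0 mult.right_neutral mult_zero_right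
        add.right_neutral order_refl)
qed

lemma endpoints_0: "endpoints 0 = {0, 1}"
  by (auto simp: endpoints_def words_def S_def)

lemma zero_one_in_endpoints: "0 \<in> endpoints n \<and> 1 \<in> endpoints n"
  by (induction n) (use endpoints_0 endpoints_subset_Suc in auto)

text \<open>The separate clause for level 0 agrees with the general one, because \<open>d 1\<close>,
  the image of 0 under the second map, is a point of \<open>K\<close> strictly between 0 and
  1.\<close>

lemma net_intervals_iff:
  "(a, b) \<in> net_intervals n \<longleftrightarrow> a \<in> endpoints n \<and> b \<in> endpoints n \<and> a < b \<and>
     {a<..<b} \<inter> endpoints n = {} \<and> {a<..<b} \<inter> K \<noteq> {}"
proof (cases "n = 0")
  case True
  have "d 1 \<in> K" using sim_in_K[of 1 0] zero_in_K m_ge_1 by simp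
  moreover have "0 < d 1" using d_pos[of 1] m_ge_1 by simp
  moreover have "d 1 < 1" using d_le[of 1] m_ge_1 d_top rho_pos by simp
  ultimately have "{0<..<1} \<inter> K \<noteq> {}" by auto
  then show ?thesis using True by (auto simp: net_intervals_def endpoints_0)
qed (simp add: net_intervals_def)

lemma net_intervalD:
  assumes "\<Delta> \<in> net_intervals n"
  shows "fst \<Delta> \<in> endpoints n" "snd \<Delta> \<in> endpoints n" "fst \<Delta> < snd \<Delta>"
    "\<And>y. y \<in> endpoints n \<Longrightarrow> y \<le> fst \<Delta> \<or> snd \<Delta> \<le> y"
    "\<exists>y\<in>K. fst \<Delta> < y \<and> y < snd \<Delta>"
proof -
  obtain a b where \<Delta>: "\<Delta> = (a, b)" by fastforce
  show "fst \<Delta> \<in> endpoints n" "snd \<Delta> \<in> endpoints n" "fst \<Delta> < snd \<Delta>"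
    "\<exists>y\<in>K. fst \<Delta> < y \<and> y < snd \<Delta>"
    using assms by (auto simp: \<Delta> net_intervals_iff)
  fix y assume "y \<in> endpoints n"
  moreover have "{a<..<b} \<inter> endpoints n = {}" using assms by (simp add: \<Delta> net_intervals_iff)
  ultimately show "y \<le> fst \<Delta> \<or> snd \<Delta> \<le> y" 
    by (metis \<Delta> disjoint_iff fst_conv snd_conv greaterThanLessThan_iff not_le)
qed

lemma finite_net_intervals: "finite (net_intervals n)"
proof (rule finite_subset)
  show "net_intervals n \<subseteq> endpoints n \<times> endpoints n" by (auto simp: net_intervals_iff)
qed (simp add: finite_endpoints)

text \<open>Both ends of the image are endpoints of level \<open>n\<close>, so neither can lie
  inside the net interval.\<close>

lemma neighbour_if_meets_interior:
  assumes "\<Delta> \<in> net_intervals n" "\<sigma> \<in> words n" "fst \<Delta> < y" "y < snd \<Delta>" "y \<in> S \<sigma> ` {0..1}"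
  shows "ivl \<Delta> \<subseteq> S \<sigma> ` {0..1}"
proof -
  have "S \<sigma> 0 \<in> endpoints n" "S \<sigma> 0 + \<rho> ^ n \<in> endpoints n" using assms by (auto simp: endpoints_iff)
  from net_intervalD(4)[OF assms(1) this(1)] net_intervalD(4)[OF assms(1) this(2)]
  show ?thesis using assms by (auto simp: S_image_unit ivl_def)
qed

lemma net_intervals_overlap_eq:
  assumes "\<Delta> \<in> net_intervals n" "\<Delta>' \<in> net_intervals n"
    and "fst \<Delta> < y" "y < snd \<Delta>" "fst \<Delta>' < y" "y < snd \<Delta>'"
  shows "\<Delta> = \<Delta>'"
proof (rule prod_eqI)
  note D = net_intervalD(4)[OF assms(1)] and D' = net_intervalD(4)[OF assms(2)]
  show "fst \<Delta> = fst \<Delta>'"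
    using D[OF net_intervalD(1)[OF assms(2)]] D'[OF net_intervalD(1)[OF assms(1)]] assms by auto
  show "snd \<Delta> = snd \<Delta>'"
    using D[OF net_intervalD(2)[OF assms(2)]] D'[OF net_intervalD(2)[OF assms(1)]] assms by auto
qed

lemma ex_net_interval:
  assumes "y \<in> K" "y \<notin> endpoints n"
  obtains \<Delta> where "\<Delta> \<in> net_intervals n" "fst \<Delta> < y" "y < snd \<Delta>"
proof -
  define A where "A = {e \<in> endpoints n. e \<le> y}"
  define B where "B = {e \<in> endpoints n. y \<le> e}"
  have fin: "finite A" "finite B" using finite_endpoints by (auto simp: A_def B_def)
  have "0 \<le> y" "y \<le> 1" using assms K_subset by auto
  \<comment> \<open>0 and 1 are endpoints of every level, so \<open>y\<close> has an endpoint on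
    either side.\<close>
  then have "A \<noteq> {}" "B \<noteq> {}" using zero_one_in_endpoints[of n] by (auto simp: A_def B_def)
  note A = Max_in[OF fin(1) this(1)] Max_ge[OF fin(1)] and B = Min_in[OF fin(2) this(2)] Min_le[OF fin(2)]
  have lt: "Max A < y" "y < Min B" using A(1) B(1) assms(2) by (auto simp: A_def B_def less_le)
  have "(Max A, Min B) \<in> net_intervals n"
    unfolding net_intervals_iff
  proof (intro conjI)
    show "{Max A<..<Min B} \<inter> endpoints n = {}"
    proof (rule ccontr)
      assume "{Max A<..<Min B} \<inter> endpoints n \<noteq> {}"
      then obtain e where e: "e \<in> endpoints n" "Max A < e" "e < Min B" by auto
      then have "e \<in> A \<or> e \<in> B" by (auto simp: A_def B_def)
      then show False using e A(2)[of e] B(2)[of e] by auto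
    qed
  qed (use A(1) B(1) lt assms in \<open>auto simp: A_def B_def\<close>)
  then show ?thesis using that[of "(Max A, Min B)"] lt by simp
qed

text \<open>Endpoints persist to the next level, so no end of \<Gamma> falls inside
  \<Delta>.\<close>

lemma parent_if_overlap:
  assumes "\<Gamma> \<in> net_intervals n" "\<Delta> \<in> net_intervals (Suc n)"
    and "fst \<Delta> < y" "y < snd \<Delta>" "fst \<Gamma> < y" "y < snd \<Gamma>"
  shows "parent n \<Gamma> \<Delta>"
proof -
  have "fst \<Gamma> \<in> endpoints (Suc n)" "snd \<Gamma> \<in> endpoints (Suc n)"
    using net_intervalD(1,2)[OF assms(1)] endpoints_subset_Suc by auto
  from this[THEN net_intervalD(4)[OF assms(2)]] show ?thesis
    unfolding parent_def using assms by (auto simp: ivl_def)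
qed

lemma parentD:
  assumes "parent n \<Gamma> \<Delta>"
  shows "\<Gamma> \<in> net_intervals n" "\<Delta> \<in> net_intervals (Suc n)" "fst \<Gamma> \<le> fst \<Delta>" "snd \<Delta> \<le> snd \<Gamma>"
    "fst \<Delta> < snd \<Delta>"
proof -
  show *: "\<Gamma> \<in> net_intervals n" "\<Delta> \<in> net_intervals (Suc n)" using assms by (auto simp: parent_def)
  show "fst \<Delta> < snd \<Delta>" using net_intervalD(3)[OF *(2)] .
  then show "fst \<Gamma> \<le> fst \<Delta>" "snd \<Delta> \<le> snd \<Gamma>" using assms by (auto simp: parent_def ivl_def)
qed

lemma parent_unique:
  assumes "parent n \<Gamma> \<Delta>" "parent n \<Gamma>' \<Delta>"
  shows "\<Gamma> = \<Gamma>'"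
proof -
  \<comment> \<open>The midpoint of the child is interior to both candidates.\<close>
  have "fst \<Delta> < (fst \<Delta> + snd \<Delta>) / 2" "(fst \<Delta> + snd \<Delta>) / 2 < snd \<Delta>"
    using parentD(5)[OF assms(1)] by auto
  then show ?thesis
    using net_intervals_overlap_eq[of \<Gamma> n \<Gamma>' "(fst \<Delta> + snd \<Delta>) / 2"]
      parentD[OF assms(1)] parentD[OF assms(2)] by auto
qed

section \<open>Neighbour sets\<close>

lemma set_neighbour_set:
  "set (neighbour_set n \<Delta>) =
    {(fst \<Delta> - S \<sigma> 0) / \<rho> ^ n | \<sigma>. \<sigma> \<in> words n \<and> ivl \<Delta> \<subseteq> S \<sigma> ` {0..1}}"
  unfolding neighbour_set_def by (rule set_sorted_list_of_set) (auto simp: finite_words)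

lemma distinct_neighbour_set: "distinct (neighbour_set n \<Delta>)"
  unfolding neighbour_set_def by simp

lemma mem_neighbour_set_iff:
  "c \<in> set (neighbour_set n \<Delta>) \<longleftrightarrow>
    (\<exists>\<sigma>\<in>words n. ivl \<Delta> \<subseteq> S \<sigma> ` {0..1} \<and> S \<sigma> 0 = fst \<Delta> - \<rho> ^ n * c)"
  unfolding set_neighbour_set using rho_pos by (auto simp: field_simps)

text \<open>A point of \<open>K\<close> inside the interval lies in the image of \<open>K\<close>
  under some word of length \<open>n\<close>, and an image of the unit interval that meets the
  interior covers the whole net interval.\<close>

lemma neighbour_set_nonempty:
  assumes "\<Delta> \<in> net_intervals n"
  obtains \<sigma> where "\<sigma> \<in> words n" "ivl \<Delta> \<subseteq> S \<sigma> ` {0..1}"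
proof -
  obtain y where y: "y \<in> K" "fst \<Delta> < y" "y < snd \<Delta>" using net_intervalD(5)[OF assms] by blast
  obtain \<sigma> z where \<sigma>: "\<sigma> \<in> words n" "z \<in> K" "y = S \<sigma> z" using y(1) by (rule K_wordE)
  have "y \<in> S \<sigma> ` {0..1}" using \<sigma> K_subset by blast
  from neighbour_if_meets_interior[OF assms \<sigma>(1) y(2,3) this] that \<sigma>(1) show thesis by blast
qed

lemma length_neighbour_set_pos:
  assumes "\<Delta> \<in> net_intervals n"
  shows "0 < length (neighbour_set n \<Delta>)"
proof -
  obtain \<sigma> where "\<sigma> \<in> words n" "ivl \<Delta> \<subseteq> S \<sigma> ` {0..1}" using neighbour_set_nonempty[OF assms] .
  then have "set (neighbour_set n \<Delta>) \<noteq> {}" unfolding set_neighbour_set by blast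
  then show ?thesis by (metis length_greater_0_conv list.set(1))
qed

text \<open>
  Children of a net interval of normalized length \<open>L\<close> with neighbour set \<open>C\<close>, in the coordinate
  \<open>z = (y - a) / \<rho> ^ n\<close> based at its left endpoint \<open>a\<close>.
\<close>
definition child_endpoints :: "real \<Rightarrow> real set \<Rightarrow> real set" where
  "child_endpoints L C =
     {0, L} \<union> ({0<..<L} \<inter> {e. \<exists>c\<in>C. \<exists>l\<in>{0..m}. e = d l - c \<or> e = d l + \<rho> - c})"

definition child_shapes :: "real \<Rightarrow> real set \<Rightarrow> (real \<times> real) set" where
  "child_shapes L C =
     {(u, v). u \<in> child_endpoints L C \<and> v \<in> child_endpoints L C \<and> u < v \<and>
        {u<..<v} \<inter> child_endpoints L C = {} \<and> (\<exists>z\<in>{u<..<v}. \<exists>c\<in>C. z + c \<in> K)}"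

definition relative_position :: "nat \<Rightarrow> net_interval \<Rightarrow> net_interval \<Rightarrow> real \<times> real" where
  "relative_position n \<Gamma> \<Delta> = ((fst \<Delta> - fst \<Gamma>) / \<rho> ^ n, (snd \<Delta> - fst \<Gamma>) / \<rho> ^ n)"

text \<open>Endpoints of the next level inside \<Gamma> can only come from words whose images cover
  \<Gamma>, so they can be read off from the normalized length and the neighbour set.\<close>

lemma child_endpoints_iff:
  assumes \<Gamma>: "\<Gamma> \<in> net_intervals n"
  shows "u \<in> child_endpoints (normalized_length n \<Gamma>) (set (neighbour_set n \<Gamma>)) \<longleftrightarrow>
    fst \<Gamma> + \<rho> ^ n * u \<in> endpoints (Suc n) \<and> fst \<Gamma> + \<rho> ^ n * u \<in> ivl \<Gamma>"
    (is "u \<in> ?E \<longleftrightarrow> ?y \<in> _ \<and> _")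
proof -
  let ?l = "normalized_length n \<Gamma>"
  have rp: "0 < \<rho> ^ n" by (rule rho_power_pos)
  have l: "\<rho> ^ n * ?l = snd \<Gamma> - fst \<Gamma>" using rp by (simp add: normalized_length_def)
  have u_iff: "0 < u \<longleftrightarrow> fst \<Gamma> < ?y" "u < ?l \<longleftrightarrow> ?y < snd \<Gamma>"
    "u = 0 \<longleftrightarrow> fst \<Gamma> = ?y" "u = ?l \<longleftrightarrow> ?y = snd \<Gamma>"
    using rp rho_pos by (auto simp: zero_less_mult_iff normalized_length_def field_simps)
  have lt: "fst \<Gamma> < snd \<Gamma>" by (rule net_intervalD(3)[OF \<Gamma>])
  consider "u = 0 \<or> u = ?l" | "0 < u" "u < ?l" | "u \<notin> {0..?l}"
    by (metis atLeastAtMost_iff order_le_less)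
  then show ?thesis
  proof cases
    case 1
    then have "?y = fst \<Gamma> \<or> ?y = snd \<Gamma>" using u_iff(3,4) by metis
    then have "?y \<in> endpoints (Suc n)" "?y \<in> ivl \<Gamma>"
      using net_intervalD(1,2)[OF \<Gamma>, THEN subsetD[OF endpoints_subset_Suc]] lt
      by (auto simp: ivl_def)
    then show ?thesis using 1 by (auto simp: child_endpoints_def)
  next
    case 2
    then have y: "fst \<Gamma> < ?y" "?y < snd \<Gamma>" using u_iff(1,2) by blast+
    have "u \<in> ?E \<longleftrightarrow> (\<exists>c\<in>set (neighbour_set n \<Gamma>). \<exists>l\<in>{0..m}. u = d l - c \<or> u = d l + \<rho> - c)"
      using 2 by (auto simp: child_endpoints_def)
    also have "\<dots> \<longleftrightarrow> ?y \<in> endpoints (Suc n)"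
    proof
      assume "\<exists>c\<in>set (neighbour_set n \<Gamma>). \<exists>l\<in>{0..m}. u = d l - c \<or> u = d l + \<rho> - c"
      then obtain c l where c: "c \<in> set (neighbour_set n \<Gamma>)" "l \<in> {0..m}"
        "u = d l - c \<or> u = d l + \<rho> - c" by blast
      then obtain \<sigma> where \<sigma>: "\<sigma> \<in> words n" "S \<sigma> 0 = fst \<Gamma> - \<rho> ^ n * c"
        by (auto simp: mem_neighbour_set_iff)
      have "?y = S \<sigma> 0 + \<rho> ^ n * d l \<or> ?y = S \<sigma> 0 + \<rho> ^ n * (d l + \<rho>)"
        using c(3) unfolding \<sigma>(2) by (elim disjE; hypsubst) (simp_all add: algebra_simps)
      then show "?y \<in> endpoints (Suc n)" unfolding endpoints_Suc_iff using \<sigma> c by blast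
    next
      assume "?y \<in> endpoints (Suc n)"
      then obtain \<sigma> l where \<sigma>: "\<sigma> \<in> words n" "l \<in> {0..m}"
        "?y = S \<sigma> 0 + \<rho> ^ n * d l \<or> ?y = S \<sigma> 0 + \<rho> ^ n * (d l + \<rho>)"
        by (auto simp: endpoints_Suc_iff)
      \<comment> \<open>The image of an extension by one letter stays inside the image of \<sigma>,
        which therefore contains an interior point of \<Gamma>.\<close>
      have "\<rho> ^ n * (d l + \<rho>) \<le> \<rho> ^ n * 1" "0 \<le> \<rho> ^ n * d l" "\<rho> ^ n * d l \<le> \<rho> ^ n * (d l + \<rho>)"
        using rp d_le[OF \<sigma>(2)] d_nonneg[OF \<sigma>(2)] d_top rho_pos by (auto intro!: mult_left_mono)
      then have "?y \<in> S \<sigma> ` {0..1}" using \<sigma>(3) by (auto simp: S_image_unit[OF \<sigma>(1)])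
      from neighbour_if_meets_interior[OF \<Gamma> \<sigma>(1) y this]
      have "(fst \<Gamma> - S \<sigma> 0) / \<rho> ^ n \<in> set (neighbour_set n \<Gamma>)"
        unfolding set_neighbour_set using \<sigma>(1) by blast
      moreover have "u = d l - (fst \<Gamma> - S \<sigma> 0) / \<rho> ^ n \<or> u = d l + \<rho> - (fst \<Gamma> - S \<sigma> 0) / \<rho> ^ n"
        using \<sigma>(3) rp by (auto simp: field_simps)
      ultimately show "\<exists>c\<in>set (neighbour_set n \<Gamma>). \<exists>l\<in>{0..m}. u = d l - c \<or> u = d l + \<rho> - c"
        using \<sigma>(2) by blast
    qed
    finally show ?thesis using y by (auto simp: ivl_def)
  next
    case 3
    have "0 < ?l" using lt rp by (simp add: normalized_length_def)
    then have "u \<notin> ?E" using 3 by (auto simp: child_endpoints_def)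
    moreover have "?y \<notin> ivl \<Gamma>"
      using 3 u_iff unfolding ivl_def atLeastAtMost_iff le_less by metis
    ultimately show ?thesis by simp
  qed
qed

text \<open>Inside \<Gamma> the set \<open>K\<close> consists of the pieces given by the covering
  words, and in the normalized coordinate these pieces are translates of \<open>K\<close> by the
  neighbours.\<close>

lemma child_meets_K_iff:
  assumes \<Gamma>: "\<Gamma> \<in> net_intervals n" and y: "fst \<Gamma> < fst \<Gamma> + \<rho> ^ n * z" "fst \<Gamma> + \<rho> ^ n * z < snd \<Gamma>"
  shows "(\<exists>c\<in>set (neighbour_set n \<Gamma>). z + c \<in> K) \<longleftrightarrow> fst \<Gamma> + \<rho> ^ n * z \<in> K"
    (is "_ \<longleftrightarrow> ?y \<in> K")
proof
  assume "\<exists>c\<in>set (neighbour_set n \<Gamma>). z + c \<in> K"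
  then obtain c \<sigma> where c: "z + c \<in> K" "\<sigma> \<in> words n" "S \<sigma> 0 = fst \<Gamma> - \<rho> ^ n * c"
    by (auto simp: mem_neighbour_set_iff)
  have "?y = S \<sigma> (z + c)" unfolding S_affine[OF c(2), of "z + c"] c(3) by (simp add: algebra_simps)
  then show "?y \<in> K" using S_in_K c by simp
next
  assume "?y \<in> K"
  then obtain \<sigma> w where \<sigma>: "\<sigma> \<in> words n" "w \<in> K" "?y = S \<sigma> w" by (rule K_wordE)
  then have "?y \<in> S \<sigma> ` {0..1}" using K_subset by auto
  from neighbour_if_meets_interior[OF \<Gamma> \<sigma>(1) y this]
  have "(fst \<Gamma> - S \<sigma> 0) / \<rho> ^ n \<in> set (neighbour_set n \<Gamma>)"
    unfolding set_neighbour_set using \<sigma>(1) by blast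
  moreover have "z + (fst \<Gamma> - S \<sigma> 0) / \<rho> ^ n = w"
  proof -
    have "\<rho> ^ n * (z + (fst \<Gamma> - S \<sigma> 0) / \<rho> ^ n) = \<rho> ^ n * w"
      using \<sigma>(3) unfolding S_affine[OF \<sigma>(1), of w] by (simp add: distrib_left)
    then show ?thesis by (subst (asm) mult_cancel_left) simp
  qed
  ultimately show "\<exists>c\<in>set (neighbour_set n \<Gamma>). z + c \<in> K" using \<sigma>(2) by metis
qed

lemma affine_at_relative:
  "fst \<Gamma> + \<rho> ^ n * ((y - fst \<Gamma>) / \<rho> ^ n) = y"
  by simp

text \<open>The shapes are computed from normalized length and neighbour set alone, so the relative
  placement of the children becomes a function of the characteristic vector of the parent.\<close>

lemma parent_iff_child_shape:
  assumes \<Gamma>: "\<Gamma> \<in> net_intervals n"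
  shows "parent n \<Gamma> \<Delta> \<longleftrightarrow>
    relative_position n \<Gamma> \<Delta> \<in> child_shapes (normalized_length n \<Gamma>) (set (neighbour_set n \<Gamma>))"
proof -
  let ?E = "child_endpoints (normalized_length n \<Gamma>) (set (neighbour_set n \<Gamma>))"
  \<comment> \<open>\<open>g\<close> undoes the normalization, and \<open>u\<close>,
    \<open>v\<close> are the ends of \<Delta> in the normalized coordinate.\<close>
  define g where "g z = fst \<Gamma> + \<rho> ^ n * z" for z
  define u v where "u = (fst \<Delta> - fst \<Gamma>) / \<rho> ^ n" and "v = (snd \<Delta> - fst \<Gamma>) / \<rho> ^ n"
  have g: "g u = fst \<Delta>" "g v = snd \<Delta>"
    by (simp_all add: g_def u_def v_def affine_at_relative)
  have g_less: "g z < g z' \<longleftrightarrow> z < z'" for z z'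
    using rho_power_pos[of n] by (simp add: g_def)
  have g_surj: "\<exists>z. y = g z" for y
    unfolding g_def by (rule exI, rule affine_at_relative[symmetric])
  have E: "z \<in> ?E \<longleftrightarrow> g z \<in> endpoints (Suc n) \<and> g z \<in> ivl \<Gamma>" for z
    unfolding g_def by (rule child_endpoints_iff[OF \<Gamma>])
  have Kz: "(\<exists>c\<in>set (neighbour_set n \<Gamma>). z + c \<in> K) \<longleftrightarrow> g z \<in> K" if "fst \<Gamma> < g z" "g z < snd \<Gamma>" for z
    using child_meets_K_iff[OF \<Gamma>] that unfolding g_def by blast
  have "parent n \<Gamma> \<Delta> \<longleftrightarrow> (u, v) \<in> child_shapes (normalized_length n \<Gamma>) (set (neighbour_set n \<Gamma>))"
  proof
    assume P: "parent n \<Gamma> \<Delta>"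
    note P' = parentD[OF P]
    have "u \<in> ?E" "v \<in> ?E" "u < v"
      using P' net_intervalD(1,2)[OF P'(2)] g_less[of u v] unfolding E g by (auto simp: ivl_def)
    moreover have "{u<..<v} \<inter> ?E = {}"
    proof (rule ccontr)
      assume "{u<..<v} \<inter> ?E \<noteq> {}"
      then obtain z where "z \<in> ?E" "u < z" "z < v" by auto
      then have "g z \<in> endpoints (Suc n)" "fst \<Delta> < g z" "g z < snd \<Delta>"
        using g_less[of u z] g_less[of z v] g E by auto
      then show False using net_intervalD(4)[OF P'(2), of "g z"] by auto
    qed
    moreover have "\<exists>z\<in>{u<..<v}. \<exists>c\<in>set (neighbour_set n \<Gamma>). z + c \<in> K"
    proof -
      obtain y where y: "y \<in> K" "fst \<Delta> < y" "y < snd \<Delta>" using net_intervalD(5)[OF P'(2)] by blast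
      obtain z where z: "y = g z" using g_surj by blast
      have "u < z" "z < v" using y g_less[of u z] g_less[of z v] unfolding g z by auto
      moreover have "\<exists>c\<in>set (neighbour_set n \<Gamma>). z + c \<in> K"
        using Kz[of z] y P' unfolding z by auto
      ultimately show ?thesis by auto
    qed
    ultimately show "(u, v) \<in> child_shapes (normalized_length n \<Gamma>) (set (neighbour_set n \<Gamma>))"
      by (auto simp: child_shapes_def)
  next
    assume "(u, v) \<in> child_shapes (normalized_length n \<Gamma>) (set (neighbour_set n \<Gamma>))"
    then have uv: "u \<in> ?E" "v \<in> ?E" "u < v" "{u<..<v} \<inter> ?E = {}"
      and "\<exists>z\<in>{u<..<v}. \<exists>c\<in>set (neighbour_set n \<Gamma>). z + c \<in> K"
      by (auto simp: child_shapes_def)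
    then obtain z where z: "u < z" "z < v" "\<exists>c\<in>set (neighbour_set n \<Gamma>). z + c \<in> K"
      by (meson greaterThanLessThan_iff)
    have \<Delta>: "fst \<Delta> \<in> endpoints (Suc n)" "snd \<Delta> \<in> endpoints (Suc n)" "fst \<Delta> < snd \<Delta>"
      and sub: "fst \<Delta> \<in> ivl \<Gamma>" "snd \<Delta> \<in> ivl \<Gamma>"
      using uv(1-3) g_less[of u v] unfolding E g by auto
    have gz: "fst \<Delta> < g z" "g z < snd \<Delta>" using z(1,2) g_less[of u z] g_less[of z v] unfolding g by auto
    then have "g z \<in> K" using Kz[of z] z(3) sub by (auto simp: ivl_def)
    then have "{fst \<Delta><..<snd \<Delta>} \<inter> K \<noteq> {}" using gz by auto
    moreover have "{fst \<Delta><..<snd \<Delta>} \<inter> endpoints (Suc n) = {}"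
    proof (rule ccontr)
      assume "{fst \<Delta><..<snd \<Delta>} \<inter> endpoints (Suc n) \<noteq> {}"
      then obtain e where e: "fst \<Delta> < e" "e < snd \<Delta>" "e \<in> endpoints (Suc n)" by auto
      obtain w where w: "e = g w" using g_surj by blast
      have "u < w" "w < v" using e g_less[of u w] g_less[of w v] unfolding g w by auto
      moreover have "w \<in> ?E" unfolding E using e sub unfolding w by (auto simp: ivl_def)
      ultimately show False using uv(4) by auto
    qed
    ultimately have "(fst \<Delta>, snd \<Delta>) \<in> net_intervals (Suc n)"
      unfolding net_intervals_iff using \<Delta> by auto
    then show "parent n \<Gamma> \<Delta>"
      unfolding parent_def using \<Gamma> sub by (auto simp: ivl_def)
  qed
  then show ?thesis by (simp add: relative_position_def u_def v_def)
qed

end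

section \<open>Transition matrices\<close>

context equicontractive_ifs
begin

section \<open>Placement of children determined by characteristic vectors\<close>

lemma relative_position_length:
  "snd (relative_position n \<Gamma> \<Delta>) - fst (relative_position n \<Gamma> \<Delta>) = \<rho> * normalized_length (Suc n) \<Delta>"
proof -
  have "snd (relative_position n \<Gamma> \<Delta>) - fst (relative_position n \<Gamma> \<Delta>) = (snd \<Delta> - fst \<Delta>) / \<rho> ^ n"
    by (simp add: relative_position_def diff_divide_distrib)
  then show ?thesis by (simp add: normalized_length_def)
qed

text \<open>Rescaling a child to its relative position is injective, keeps the left-to-right order
  and multiplies normalized lengths by one common factor. Siblings can therefore be counted among
  the shapes, which depend only on the vector of the parent.\<close>

lemma position_eq_card_shapes:
  assumes P: "parent n \<Gamma> \<Delta>"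
  shows "position (Suc n) \<Delta> =
    card {w \<in> child_shapes (normalized_length n \<Gamma>) (set (neighbour_set n \<Gamma>)).
            snd w - fst w = snd (relative_position n \<Gamma> \<Delta>) - fst (relative_position n \<Gamma> \<Delta>) \<and>
            fst w \<le> fst (relative_position n \<Gamma> \<Delta>)}"
proof -
  let ?P = "child_shapes (normalized_length n \<Gamma>) (set (neighbour_set n \<Gamma>))"
  let ?r = "relative_position n \<Gamma>"
  define A where "A = {\<Delta>'. parent n \<Gamma> \<Delta>' \<and>
    normalized_length (Suc n) \<Delta>' = normalized_length (Suc n) \<Delta> \<and> fst \<Delta>' \<le> fst \<Delta>}"
  have sib: "(\<exists>\<Gamma>'. parent n \<Gamma>' \<Delta> \<and> parent n \<Gamma>' \<Delta>') \<longleftrightarrow> parent n \<Gamma> \<Delta>'" for \<Delta>'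
    using P parent_unique by blast
  have "{\<Delta>' \<in> net_intervals (Suc n). (\<exists>\<Gamma>'. parent n \<Gamma>' \<Delta> \<and> parent n \<Gamma>' \<Delta>') \<and>
      normalized_length (Suc n) \<Delta>' = normalized_length (Suc n) \<Delta> \<and> fst \<Delta>' \<le> fst \<Delta>} = A"
    unfolding A_def sib using parentD(2) by blast
  then have pos: "position (Suc n) \<Delta> = card A" by (simp add: position_def)
  have \<Gamma>: "\<Gamma> \<in> net_intervals n" by (rule parentD(1)[OF P])
  have len: "snd (?r \<Delta>') - fst (?r \<Delta>') = \<rho> * normalized_length (Suc n) \<Delta>'" for \<Delta>'
    by (rule relative_position_length)
  have le: "fst (?r \<Delta>') \<le> fst (?r \<Delta>) \<longleftrightarrow> fst \<Delta>' \<le> fst \<Delta>" for \<Delta>'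
    using rho_pos by (simp add: relative_position_def divide_le_cancel)
  have "?r ` A = {w \<in> ?P. snd w - fst w = snd (?r \<Delta>) - fst (?r \<Delta>) \<and> fst w \<le> fst (?r \<Delta>)}"
  proof (intro equalityI subsetI)
    fix w assume "w \<in> {w \<in> ?P. snd w - fst w = snd (?r \<Delta>) - fst (?r \<Delta>) \<and> fst w \<le> fst (?r \<Delta>)}"
    then have w: "w \<in> ?P" "snd w - fst w = snd (?r \<Delta>) - fst (?r \<Delta>)" "fst w \<le> fst (?r \<Delta>)" by auto
    define \<Delta>' where "\<Delta>' = (fst \<Gamma> + \<rho> ^ n * fst w, fst \<Gamma> + \<rho> ^ n * snd w)"
    have r: "?r \<Delta>' = w" by (simp add: relative_position_def \<Delta>'_def)
    have "\<Delta>' \<in> A"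
      using w len[of \<Delta>'] len[of \<Delta>] le[of \<Delta>'] unfolding A_def
      by (simp add: parent_iff_child_shape[OF \<Gamma>] r)
    then show "w \<in> ?r ` A" using r by force
  qed (use len le in \<open>auto simp: A_def parent_iff_child_shape[OF \<Gamma>]\<close>)
  moreover have "inj_on ?r A"
    by (auto simp: inj_on_def relative_position_def prod_eq_iff)
  ultimately show ?thesis unfolding pos by (metis card_image)
qed

lemma finite_child_shapes:
  assumes \<Gamma>: "\<Gamma> \<in> net_intervals n"
  shows "finite (child_shapes (normalized_length n \<Gamma>) (set (neighbour_set n \<Gamma>)))"
proof (rule finite_subset)
  show "child_shapes (normalized_length n \<Gamma>) (set (neighbour_set n \<Gamma>)) \<subseteq>
    relative_position n \<Gamma> ` net_intervals (Suc n)"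
  proof
    fix w assume w: "w \<in> child_shapes (normalized_length n \<Gamma>) (set (neighbour_set n \<Gamma>))"
    define \<Delta>' where "\<Delta>' = (fst \<Gamma> + \<rho> ^ n * fst w, fst \<Gamma> + \<rho> ^ n * snd w)"
    have r: "relative_position n \<Gamma> \<Delta>' = w" by (simp add: relative_position_def \<Delta>'_def)
    then have "parent n \<Gamma> \<Delta>'" using w parent_iff_child_shape[OF \<Gamma>] by simp
    then show "w \<in> relative_position n \<Gamma> ` net_intervals (Suc n)"
      using r parentD(2) by blast
  qed
qed (simp add: finite_net_intervals)

text \<open>
  Equal vectors give the same set of child shapes, and siblings of equal length are told apart by
  the third component of the vector.
\<close>
lemma relative_position_unique:
  assumes "realizes_step \<gamma> \<gamma>' (n, \<Gamma>, \<Delta>)" "realizes_step \<gamma> \<gamma>' (n', \<Gamma>', \<Delta>')"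
  shows "relative_position n \<Gamma> \<Delta> = relative_position n' \<Gamma>' \<Delta>'"
proof -
  define P where "P = child_shapes (normalized_length n \<Gamma>) (set (neighbour_set n \<Gamma>))"
  have p: "parent n \<Gamma> \<Delta>" and p': "parent n' \<Gamma>' \<Delta>'"
    and c: "char_vector n \<Gamma> = char_vector n' \<Gamma>'"
      "char_vector (Suc n) \<Delta> = char_vector (Suc n') \<Delta>'"
    using assms by (auto simp: realizes_step_def)
  have P': "P = child_shapes (normalized_length n' \<Gamma>') (set (neighbour_set n' \<Gamma>'))"
    using c(1) by (simp add: P_def char_vector_def)
  define w w' where "w = relative_position n \<Gamma> \<Delta>" and "w' = relative_position n' \<Gamma>' \<Delta>'"
  have P_mem: "w \<in> P" "w' \<in> P"
    using p p' parent_iff_child_shape[OF parentD(1)[OF p]] parent_iff_child_shape[OF parentD(1)[OF p']]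
    unfolding P_def[symmetric] P'[symmetric] w_def w'_def by blast+
  have fin: "finite P" unfolding P_def by (rule finite_child_shapes[OF parentD(1)[OF p]])
  have len: "snd w - fst w = snd w' - fst w'"
    using c(2) unfolding w_def w'_def relative_position_length by (simp add: char_vector_def)
  define C where "C z = {y \<in> P. snd y - fst y = snd z - fst z \<and> fst y \<le> fst z}" for z :: "real \<times> real"
  have card: "card (C w) = card (C w')"
    using position_eq_card_shapes[OF p] position_eq_card_shapes[OF p'] c(2)
    unfolding P_def[symmetric] P'[symmetric] w_def[symmetric] w'_def[symmetric] C_def
    by (simp add: char_vector_def)
  \<comment> \<open>\<open>z'\<close> is counted in its own class but not for a shape further left,
    so the count strictly increases and equal positions force equal left ends.\<close>
  have mono: "card (C z) < card (C z')"
    if "z' \<in> P" "snd z - fst z = snd z' - fst z'" "fst z < fst z'" for z z'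
  proof (rule psubset_card_mono)
    have "z' \<in> C z'" "z' \<notin> C z" "C z \<subseteq> C z'" using that by (auto simp: C_def)
    then show "C z \<subset> C z'" by blast
  qed (use fin in \<open>simp add: C_def\<close>)
  have "fst w = fst w'"
    using mono[of w' w] mono[of w w'] P_mem len card by (cases "fst w" "fst w'" rule: linorder_cases) auto
  then show ?thesis using len unfolding w_def[symmetric] w'_def[symmetric] by (simp add: prod_eq_iff)
qed

text \<open>Injectivity of \<open>d\<close> turns the definite description into a sum with at most
  one nonzero term, a form that can be multiplied out and compared between levels.\<close>

lemma interval_transition_entry:
  assumes p: "parent n \<Gamma> \<Delta>"
    and j: "j < length (neighbour_set n \<Gamma>)" and k: "k < length (neighbour_set (Suc n) \<Delta>)"
  shows "interval_transition p n \<Gamma> \<Delta> $$ (j, k) =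
    (\<Sum>l\<in>{0..m}. if fst \<Gamma> - \<rho> ^ n * neighbour_set n \<Gamma> ! j + \<rho> ^ n * d l =
       fst \<Delta> - \<rho> ^ Suc n * neighbour_set (Suc n) \<Delta> ! k then p l else 0)"
proof -
  define t where "t = fst \<Gamma> - \<rho> ^ n * neighbour_set n \<Gamma> ! j"
  define t' where "t' = fst \<Delta> - \<rho> ^ Suc n * neighbour_set (Suc n) \<Delta> ! k"
  define Q where "Q l \<longleftrightarrow> l \<in> {0..m} \<and> t + \<rho> ^ n * d l = t'" for l
  have "neighbour_set n \<Gamma> ! j \<in> set (neighbour_set n \<Gamma>)" using j by simp
  then obtain \<sigma> where \<sigma>: "\<sigma> \<in> words n" "S \<sigma> 0 = t" unfolding mem_neighbour_set_iff t_def by blast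
  \<comment> \<open>A word starting at \<open>t\<close> exists because \<open>t\<close> comes from a
    neighbour, so the condition reduces to an equation between numbers.\<close>
  have Q: "(l \<in> {0..m} \<and> (\<exists>\<sigma>\<in>words n. S \<sigma> 0 = t \<and> S (\<sigma> @ [l]) 0 = t')) \<longleftrightarrow> Q l" for l
  proof -
    have "S (\<tau> @ [l]) 0 = S \<tau> 0 + \<rho> ^ n * d l" if "\<tau> \<in> words n" for \<tau>
      using S_snoc[OF that, of l 0] by simp
    then show ?thesis using \<sigma> unfolding Q_def by metis
  qed
  have uniq: "l = l'" if "Q l" "Q l'" for l l'
  proof -
    have "\<rho> ^ n * d l = \<rho> ^ n * d l'" using that unfolding Q_def by linarith
    then have "d l = d l'" by simp
    then show ?thesis using that d_inj unfolding Q_def by blast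
  qed
  have "interval_transition p n \<Gamma> \<Delta> $$ (j, k) = (if \<exists>l. Q l then p (THE l. Q l) else 0)"
    unfolding interval_transition_def Let_def index_mat(1)[OF j k] prod.case
      t_def[symmetric] t'_def[symmetric] Q ..
  also have "\<dots> = (\<Sum>l\<in>{0..m}. if t + \<rho> ^ n * d l = t' then p l else 0)"
  proof (cases "\<exists>l. Q l")
    case True
    then obtain l where l: "Q l" by blast
    have "(\<Sum>l\<in>{0..m}. if t + \<rho> ^ n * d l = t' then p l else 0) = (\<Sum>i\<in>{0..m}. if i = l then p l else 0)"
      using l uniq by (intro sum.cong) (auto simp: Q_def)
    also have "\<dots> = p l" using l by (auto simp: Q_def)
    finally show ?thesis using l uniq by (metis the_equality)
  next
    case False
    then show ?thesis by (auto simp: Q_def intro!: sum.neutral[symmetric])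
  qed
  finally show ?thesis unfolding t_def t'_def .
qed

lemma interval_transition_dim [simp]:
  "dim_row (interval_transition p n \<Gamma> \<Delta>) = length (neighbour_set n \<Gamma>)"
  "dim_col (interval_transition p n \<Gamma> \<Delta>) = length (neighbour_set (Suc n) \<Delta>)"
  by (simp_all add: interval_transition_def Let_def)

text \<open>This justifies the choice made in \<open>primitive_transition\<close>: after division by
  \<open>\<rho> ^ n\<close> the condition for each entry involves only the neighbours and the
  relative position of the child, and the two vectors determine these.\<close>

lemma primitive_transition_eq:
  assumes "realizes_step \<gamma> \<gamma>' (n, \<Gamma>, \<Delta>)"
  shows "primitive_transition p \<gamma> \<gamma>' = interval_transition p n \<Gamma> \<Delta>"
proof -
  obtain n' \<Gamma>' \<Delta>' where w: "(SOME w. realizes_step \<gamma> \<gamma>' w) = (n', \<Gamma>', \<Delta>')"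
    by (metis prod_cases3)
  then have r: "realizes_step \<gamma> \<gamma>' (n', \<Gamma>', \<Delta>')" using someI[of "realizes_step \<gamma> \<gamma>'"] assms by metis
  have nb: "neighbour_set n' \<Gamma>' = neighbour_set n \<Gamma>" "neighbour_set (Suc n') \<Delta>' = neighbour_set (Suc n) \<Delta>"
    and p: "parent n \<Gamma> \<Delta>" "parent n' \<Gamma>' \<Delta>'"
    using r assms by (auto simp: realizes_step_def char_vector_def)
  have iff: "fst \<Gamma> - \<rho> ^ n * c + \<rho> ^ n * e = fst \<Delta> - \<rho> ^ Suc n * a \<longleftrightarrow>
      e = fst (relative_position n \<Gamma> \<Delta>) + c - \<rho> * a" for n \<Gamma> \<Delta> c e a
  proof -
    have r: "\<rho> ^ n * fst (relative_position n \<Gamma> \<Delta>) = fst \<Delta> - fst \<Gamma>"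
      by (simp add: relative_position_def)
    have "\<rho> ^ n * (fst (relative_position n \<Gamma> \<Delta>) + c - \<rho> * a) =
        fst \<Delta> - fst \<Gamma> + \<rho> ^ n * c - \<rho> ^ Suc n * a"
      unfolding right_diff_distrib distrib_left r by simp
    then have "fst \<Gamma> - \<rho> ^ n * c + \<rho> ^ n * e = fst \<Delta> - \<rho> ^ Suc n * a \<longleftrightarrow>
        \<rho> ^ n * e = \<rho> ^ n * (fst (relative_position n \<Gamma> \<Delta>) + c - \<rho> * a)"
      by linarith
    then show ?thesis by simp
  qed
  have "interval_transition p n' \<Gamma>' \<Delta>' = interval_transition p n \<Gamma> \<Delta>"
  proof (rule eq_matI)
    fix j k assume "j < dim_row (interval_transition p n \<Gamma> \<Delta>)" "k < dim_col (interval_transition p n \<Gamma> \<Delta>)"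
    then show "interval_transition p n' \<Gamma>' \<Delta>' $$ (j, k) = interval_transition p n \<Gamma> \<Delta> $$ (j, k)"
      by (subst (1 2) interval_transition_entry) (use p nb in
        \<open>simp_all only: interval_transition_dim iff relative_position_unique[OF assms r]\<close>)
  qed (simp_all add: nb)
  then show ?thesis by (simp add: primitive_transition_def w)
qed

section \<open>Word probabilities collected by neighbours\<close>

definition weight :: "(nat \<Rightarrow> real) \<Rightarrow> nat list \<Rightarrow> real" where
  "weight p \<sigma> = prod_list (map p \<sigma>)"

text \<open>A row vector, stored as a one-row matrix so that transition matrices can act on it from
  the right. Words with the same starting point have the same image, so all words summed here cover
  the interval.\<close>

definition neighbour_weights :: "(nat \<Rightarrow> real) \<Rightarrow> nat \<Rightarrow> net_interval \<Rightarrow> real mat" where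
  "neighbour_weights p n \<Delta> = mat 1 (length (neighbour_set n \<Delta>))
     (\<lambda>(_, k). \<Sum>\<sigma>\<in>{\<sigma> \<in> words n. S \<sigma> 0 = fst \<Delta> - \<rho> ^ n * neighbour_set n \<Delta> ! k}. weight p \<sigma>)"

text \<open>The quantity \<open>W\<close> of the introductory outline.\<close>

definition total_weight :: "(nat \<Rightarrow> real) \<Rightarrow> nat \<Rightarrow> net_interval \<Rightarrow> real" where
  "total_weight p n \<Delta> = (\<Sum>\<sigma>\<in>{\<sigma> \<in> words n. ivl \<Delta> \<subseteq> S \<sigma> ` {0..1}}. weight p \<sigma>)"

lemma neighbour_weights_dim [simp]:
  "dim_row (neighbour_weights p n \<Delta>) = 1"
  "dim_col (neighbour_weights p n \<Delta>) = length (neighbour_set n \<Delta>)"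
  by (simp_all add: neighbour_weights_def)

lemma weight_snoc: "weight p (\<sigma> @ [l]) = weight p \<sigma> * p l"
  by (simp add: weight_def)

lemma weight_pos: "(\<And>j. j \<in> {0..m} \<Longrightarrow> 0 < p j) \<Longrightarrow> \<sigma> \<in> words n \<Longrightarrow> 0 < weight p \<sigma>"
  unfolding weight_def words_def by (induction \<sigma> arbitrary: n) auto

lemma sum_words_Suc:
  fixes f :: "nat list \<Rightarrow> 'a :: comm_monoid_add"
  shows "(\<Sum>\<tau>\<in>words (Suc n). f \<tau>) = (\<Sum>\<sigma>\<in>words n. \<Sum>l\<in>{0..m}. f (\<sigma> @ [l]))"
proof -
  have "inj_on (\<lambda>(\<sigma>, l). \<sigma> @ [l]) (words n \<times> {0..m})" by (auto simp: inj_on_def)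
  then show ?thesis
    by (simp add: words_Suc sum.reindex sum.cartesian_product case_prod_unfold)
qed

text \<open>Neighbours are listed without repetition, so exactly one index matches a covering word.
  This collapses double sums over words and neighbours.\<close>

lemma sum_neighbour_index:
  assumes \<sigma>: "\<sigma> \<in> words n" "ivl \<Delta> \<subseteq> S \<sigma> ` {0..1}"
  shows "(\<Sum>j<length (neighbour_set n \<Delta>).
    if S \<sigma> 0 = fst \<Delta> - \<rho> ^ n * neighbour_set n \<Delta> ! j then y else (0::real)) = y"
proof -
  have "(fst \<Delta> - S \<sigma> 0) / \<rho> ^ n \<in> set (neighbour_set n \<Delta>)" using \<sigma> by (auto simp: set_neighbour_set)
  then obtain i where i: "i < length (neighbour_set n \<Delta>)"
    "neighbour_set n \<Delta> ! i = (fst \<Delta> - S \<sigma> 0) / \<rho> ^ n"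
    by (auto simp: in_set_conv_nth)
  have "S \<sigma> 0 = fst \<Delta> - \<rho> ^ n * c \<longleftrightarrow> c = neighbour_set n \<Delta> ! i" for c
    unfolding i(2) by (auto simp: field_simps)
  then have "(S \<sigma> 0 = fst \<Delta> - \<rho> ^ n * neighbour_set n \<Delta> ! j) = (j = i)"
    if "j < length (neighbour_set n \<Delta>)" for j
    using that i(1) distinct_neighbour_set[of n \<Delta>] by (simp add: nth_eq_iff_index_eq)
  then have "(\<Sum>j<length (neighbour_set n \<Delta>).
    if S \<sigma> 0 = fst \<Delta> - \<rho> ^ n * neighbour_set n \<Delta> ! j then y else (0::real)) =
    (\<Sum>j<length (neighbour_set n \<Delta>). if j = i then y else 0)"
    by (intro sum.cong) auto
  then show ?thesis using i(1) by simp
qed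

lemma sum_words_filter:
  "(\<Sum>\<sigma>\<in>{\<sigma> \<in> words n. Q \<sigma>}. f \<sigma>) = (\<Sum>\<sigma>\<in>words n. if Q \<sigma> then f \<sigma> else (0::real))"
  by (rule sum.inter_filter[OF finite_words])

text \<open>After exchanging the sums, a covering word is counted at exactly one neighbour and any
  other word at none.\<close>

lemma total_weight_eq_sum:
  "(\<Sum>k<length (neighbour_set n \<Delta>). neighbour_weights p n \<Delta> $$ (0, k)) = total_weight p n \<Delta>"
proof -
  have "(\<Sum>k<length (neighbour_set n \<Delta>). neighbour_weights p n \<Delta> $$ (0, k)) =
    (\<Sum>\<sigma>\<in>words n. \<Sum>k<length (neighbour_set n \<Delta>).
      if S \<sigma> 0 = fst \<Delta> - \<rho> ^ n * neighbour_set n \<Delta> ! k then weight p \<sigma> else 0)"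
    by (subst sum.swap) (auto simp: neighbour_weights_def sum_words_filter intro!: sum.cong)
  also have "\<dots> = (\<Sum>\<sigma>\<in>words n. if ivl \<Delta> \<subseteq> S \<sigma> ` {0..1} then weight p \<sigma> else 0)"
  proof (intro sum.cong refl)
    fix \<sigma> assume \<sigma>: "\<sigma> \<in> words n"
    show "(\<Sum>k<length (neighbour_set n \<Delta>).
        if S \<sigma> 0 = fst \<Delta> - \<rho> ^ n * neighbour_set n \<Delta> ! k then weight p \<sigma> else 0) =
      (if ivl \<Delta> \<subseteq> S \<sigma> ` {0..1} then weight p \<sigma> else 0)"
    proof (cases "ivl \<Delta> \<subseteq> S \<sigma> ` {0..1}")
      case True
      then show ?thesis using sum_neighbour_index[OF \<sigma> True] by simp
    next
      case False
      \<comment> \<open>The image of a word is determined by its left end, so a word that starts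
        where a covering word starts covers as well.\<close>
      have "S \<sigma> 0 \<noteq> fst \<Delta> - \<rho> ^ n * neighbour_set n \<Delta> ! k" if "k < length (neighbour_set n \<Delta>)" for k
      proof
        assume *: "S \<sigma> 0 = fst \<Delta> - \<rho> ^ n * neighbour_set n \<Delta> ! k"
        have "neighbour_set n \<Delta> ! k \<in> set (neighbour_set n \<Delta>)" using that by simp
        then obtain \<tau> where "\<tau> \<in> words n" "ivl \<Delta> \<subseteq> S \<tau> ` {0..1}" "S \<tau> 0 = S \<sigma> 0"
          unfolding mem_neighbour_set_iff * by auto
        then show False using False \<sigma> by (simp add: S_image_unit)
      qed
      then show ?thesis using False by simp
    qed
  qed
  finally show ?thesis by (simp add: total_weight_def sum_words_filter)
qed

text \<open>The midpoint of \<Delta> is interior to \<Gamma> and lies in the image of the extended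
  word, which is part of the image of \<sigma>.\<close>

lemma neighbour_of_parent:
  assumes p: "parent n \<Gamma> \<Delta>" and \<sigma>: "\<sigma> \<in> words n" "l \<in> {0..m}"
    and sub: "ivl \<Delta> \<subseteq> S (\<sigma> @ [l]) ` {0..1}"
  shows "ivl \<Gamma> \<subseteq> S \<sigma> ` {0..1}"
proof -
  define y where "y = (fst \<Delta> + snd \<Delta>) / 2"
  have y: "fst \<Delta> < y" "y < snd \<Delta>" using parentD(5)[OF p] by (auto simp: y_def)
  then have "y \<in> S (\<sigma> @ [l]) ` {0..1}" using sub by (auto simp: ivl_def)
  then obtain z where z: "0 \<le> z" "z \<le> 1" "y = S (\<sigma> @ [l]) z" by auto
  have "S (\<sigma> @ [l]) z = S \<sigma> (\<rho> * z + d l)" by (simp add: S_def sim_def)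
  moreover have "\<rho> * z \<le> \<rho> * 1" using z rho_pos by (intro mult_left_mono) auto
  then have "\<rho> * z + d l \<le> 1" "0 \<le> \<rho> * z + d l"
    using mult_nonneg_nonneg[of \<rho> z] z rho_pos d_le[OF \<sigma>(2)] d_nonneg[OF \<sigma>(2)] d_top
    by linarith+
  ultimately have "y \<in> S \<sigma> ` {0..1}" using z by auto
  moreover have "fst \<Gamma> < y" "y < snd \<Gamma>" using y parentD[OF p] by auto
  ultimately show ?thesis using neighbour_if_meets_interior[OF parentD(1)[OF p] \<sigma>(1)] by blast
qed

text \<open>A word of length \<open>Suc n\<close> splits into its first \<open>n\<close> letters and
  its last letter, and its weight factors accordingly.\<close>

lemma neighbour_weights_step:
  assumes p: "parent n \<Gamma> \<Delta>"
  shows "neighbour_weights p (Suc n) \<Delta> = neighbour_weights p n \<Gamma> * interval_transition p n \<Gamma> \<Delta>"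
proof (rule eq_matI)
  fix i k assume "i < dim_row (neighbour_weights p n \<Gamma> * interval_transition p n \<Gamma> \<Delta>)"
    "k < dim_col (neighbour_weights p n \<Gamma> * interval_transition p n \<Gamma> \<Delta>)"
  then have i: "i = 0" and k: "k < length (neighbour_set (Suc n) \<Delta>)" by auto
  define t where "t = fst \<Delta> - \<rho> ^ Suc n * neighbour_set (Suc n) \<Delta> ! k"
  define c where "c j = fst \<Gamma> - \<rho> ^ n * neighbour_set n \<Gamma> ! j" for j
  define g where "g \<sigma> = (\<Sum>l\<in>{0..m}. if S \<sigma> 0 + \<rho> ^ n * d l = t then p l else 0)" for \<sigma>
  let ?N = "length (neighbour_set n \<Gamma>)"
  \<comment> \<open>A prefix with an extension starting at \<open>t\<close> covers \<Gamma>, so the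
    sum over the neighbours of the parent misses no contributing prefix.\<close>
  have sub: "ivl \<Gamma> \<subseteq> S \<sigma> ` {0..1}" if "\<sigma> \<in> words n" "g \<sigma> \<noteq> 0" for \<sigma>
  proof -
    note nz = that(2)[unfolded g_def]
    obtain l where l: "l \<in> {0..m}" "S \<sigma> 0 + \<rho> ^ n * d l = t"
      using sum.not_neutral_contains_not_neutral[OF nz] by (metis (full_types))
    have "neighbour_set (Suc n) \<Delta> ! k \<in> set (neighbour_set (Suc n) \<Delta>)" using k by simp
    then obtain \<tau> where \<tau>: "\<tau> \<in> words (Suc n)" "ivl \<Delta> \<subseteq> S \<tau> ` {0..1}" "S \<tau> 0 = t"
      unfolding mem_neighbour_set_iff t_def by blast
    have "S (\<sigma> @ [l]) 0 = S \<tau> 0" using l \<tau>(3) by (simp add: S_snoc[OF that(1)])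
    then have "ivl \<Delta> \<subseteq> S (\<sigma> @ [l]) ` {0..1}"
      using \<tau> words_snoc[OF that(1) l(1)] by (simp add: S_image_unit)
    then show ?thesis using neighbour_of_parent[OF p that(1) l(1)] by blast
  qed
  have "(neighbour_weights p n \<Gamma> * interval_transition p n \<Gamma> \<Delta>) $$ (i, k) =
    (\<Sum>j<?N. neighbour_weights p n \<Gamma> $$ (0, j) * interval_transition p n \<Gamma> \<Delta> $$ (j, k))"
    using k i by (simp add: scalar_prod_def lessThan_atLeast0)
  also have "\<dots> = (\<Sum>j<?N. \<Sum>\<sigma>\<in>words n. if S \<sigma> 0 = c j then weight p \<sigma> * g \<sigma> else 0)"
  proof (rule sum.cong[OF refl])
    fix j assume "j \<in> {..<?N}"
    then have j: "j < ?N" by simp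
    have "interval_transition p n \<Gamma> \<Delta> $$ (j, k) = (\<Sum>l\<in>{0..m}. if c j + \<rho> ^ n * d l = t then p l else 0)"
      unfolding c_def t_def by (rule interval_transition_entry[OF p j k])
    moreover have "neighbour_weights p n \<Gamma> $$ (0, j) = (\<Sum>\<sigma>\<in>words n. if S \<sigma> 0 = c j then weight p \<sigma> else 0)"
      using j by (simp add: neighbour_weights_def sum_words_filter c_def)
    ultimately show "neighbour_weights p n \<Gamma> $$ (0, j) * interval_transition p n \<Gamma> \<Delta> $$ (j, k) =
      (\<Sum>\<sigma>\<in>words n. if S \<sigma> 0 = c j then weight p \<sigma> * g \<sigma> else 0)"
      by (auto simp: sum_distrib_right g_def intro!: sum.cong)
  qed
  also have "\<dots> = (\<Sum>\<sigma>\<in>words n. \<Sum>j<?N. if S \<sigma> 0 = c j then weight p \<sigma> * g \<sigma> else 0)"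
    by (rule sum.swap)
  also have "\<dots> = (\<Sum>\<sigma>\<in>words n. weight p \<sigma> * g \<sigma>)"
  proof (rule sum.cong[OF refl])
    fix \<sigma> assume \<sigma>: "\<sigma> \<in> words n"
    show "(\<Sum>j<?N. if S \<sigma> 0 = c j then weight p \<sigma> * g \<sigma> else 0) = weight p \<sigma> * g \<sigma>"
    proof (cases "g \<sigma> = 0")
      case False
      show ?thesis unfolding c_def by (rule sum_neighbour_index[OF \<sigma> sub[OF \<sigma> False]])
    qed simp
  qed
  also have "\<dots> = (\<Sum>\<sigma>\<in>words n. \<Sum>l\<in>{0..m}. if S (\<sigma> @ [l]) 0 = t then weight p (\<sigma> @ [l]) else 0)"
    by (intro sum.cong refl) (auto simp: g_def sum_distrib_left weight_snoc S_snoc intro!: sum.cong)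
  also have "\<dots> = (\<Sum>\<tau>\<in>words (Suc n). if S \<tau> 0 = t then weight p \<tau> else 0)"
    by (rule sum_words_Suc[symmetric])
  also have "\<dots> = neighbour_weights p (Suc n) \<Delta> $$ (i, k)"
    using k i by (simp only: neighbour_weights_def sum_words_filter t_def) simp
  finally show "neighbour_weights p (Suc n) \<Delta> $$ (i, k) =
    (neighbour_weights p n \<Gamma> * interval_transition p n \<Gamma> \<Delta>) $$ (i, k)" by simp
qed simp_all

end

section \<open>Periodic paths of net intervals\<close>

context equicontractive_ifs
begin

text \<open>The body of \<open>symbolic_rep\<close> with its witnessing intervals as a parameter,
  since the estimates speak about these intervals.\<close>

definition net_path :: "real \<Rightarrow> (nat \<Rightarrow> char_vec) \<Rightarrow> (nat \<Rightarrow> net_interval) \<Rightarrow> bool" where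
  "net_path x s \<Delta> \<longleftrightarrow> (\<forall>n. \<Delta> n \<in> net_intervals n \<and> x \<in> ivl (\<Delta> n) \<and>
     parent n (\<Delta> n) (\<Delta> (Suc n)) \<and> s n = char_vector n (\<Delta> n))"

lemma symbolic_rep_iff: "symbolic_rep x s \<longleftrightarrow> (\<exists>\<Delta>. net_path x s \<Delta>)"
  by (simp add: symbolic_rep_def net_path_def)

lemma net_pathD:
  assumes "net_path x s \<Delta>"
  shows "\<Delta> n \<in> net_intervals n" "x \<in> ivl (\<Delta> n)" "parent n (\<Delta> n) (\<Delta> (Suc n))"
    "s n = char_vector n (\<Delta> n)" "realizes_step (s n) (s (Suc n)) (n, \<Delta> n, \<Delta> (Suc n))"
  using assms by (auto simp: net_path_def realizes_step_def)

text \<open>A point that is not a boundary point is interior to every interval of each of its paths,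
  and an interior point determines the net interval of each level.\<close>

lemma boundary_point_if_two_reps:
  assumes "net_path x s \<Delta>" "net_path x s' \<Delta>'" "s \<noteq> s'"
  shows "boundary_point x"
proof (rule ccontr)
  assume nb: "\<not> boundary_point x"
  have "fst (\<Delta> n) < x \<and> x < snd (\<Delta> n)" if "net_path x s \<Delta>" for s \<Delta> n
    using net_pathD(1,2)[OF that, of n] nb unfolding boundary_point_def ivl_def
    by (metis atLeastAtMost_iff order_le_less)
  then have "\<Delta> n = \<Delta>' n" for n
    using net_intervals_overlap_eq net_pathD(1) assms(1,2) by metis
  then have "s = s'" using net_pathD(4)[OF assms(1)] net_pathD(4)[OF assms(2)] by auto
  with assms(3) show False by simp
qed

lemma net_interval_length_le:
  assumes "\<Delta> \<in> net_intervals n"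
  shows "snd \<Delta> - fst \<Delta> \<le> \<rho> ^ n"
proof -
  obtain \<sigma> where \<sigma>: "\<sigma> \<in> words n" "ivl \<Delta> \<subseteq> S \<sigma> ` {0..1}"
    using neighbour_set_nonempty[OF assms] .
  then have "{fst \<Delta>..snd \<Delta>} \<subseteq> {S \<sigma> 0..S \<sigma> 0 + \<rho> ^ n}" by (simp add: S_image_unit ivl_def)
  then show ?thesis using net_intervalD(3)[OF assms] by (simp add: atLeastatMost_subset_iff)
qed

lemma net_path_tendsto:
  assumes "net_path x s \<Delta>"
  shows "(\<lambda>n. fst (\<Delta> n)) \<longlonglongrightarrow> x"
proof (rule LIM_zero_cancel, rule Lim_null_comparison)
  show "\<forall>\<^sub>F n in sequentially. norm (fst (\<Delta> n) - x) \<le> \<rho> ^ n"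
  proof (rule always_eventually, rule allI)
    fix n
    show "norm (fst (\<Delta> n) - x) \<le> \<rho> ^ n"
      using net_pathD(2)[OF assms, of n] net_interval_length_le[OF net_pathD(1)[OF assms, of n]]
      by (auto simp: ivl_def)
  qed
  show "(\<lambda>n. \<rho> ^ n) \<longlonglongrightarrow> 0"
    using rho_pos rho_less_1 by (intro LIMSEQ_realpow_zero) auto
qed

text \<open>Two consecutive vectors determine the relative displacement of the left ends, so one
  period later each displacement is multiplied by \<open>\<rho> ^ L\<close>. Summing displacements
  and passing to the limit \<open>x\<close> handles the left ends; equal normalized lengths then
  handle the right ends.\<close>

lemma net_path_self_similar:
  assumes P: "net_path x s \<Delta>" and per: "\<And>n. N \<le> n \<Longrightarrow> s (n + L) = s n"
  shows "fst (\<Delta> (N + k * L)) = x + (\<rho> ^ L) ^ k * (fst (\<Delta> N) - x)"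
    and "snd (\<Delta> (N + k * L)) = x + (\<rho> ^ L) ^ k * (snd (\<Delta> N) - x)"
proof -
  define a b where "a n = fst (\<Delta> n)" and "b n = snd (\<Delta> n)" for n
  have offset: "a (Suc (n + L)) - a (n + L) = \<rho> ^ L * (a (Suc n) - a n)" if "N \<le> n" for n
  proof -
    have "realizes_step (s n) (s (Suc n)) (n + L, \<Delta> (n + L), \<Delta> (Suc (n + L)))"
      using net_pathD(5)[OF P, of "n + L"] per[of n] per[of "Suc n"] that by simp
    from relative_position_unique[OF this net_pathD(5)[OF P, of n]]
    have "(a (Suc (n + L)) - a (n + L)) / \<rho> ^ (n + L) = (a (Suc n) - a n) / \<rho> ^ n"
      by (simp add: relative_position_def a_def)
    then have "(a (Suc (n + L)) - a (n + L)) / \<rho> ^ (n + L) * \<rho> ^ (n + L) =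
        (a (Suc n) - a n) / \<rho> ^ n * \<rho> ^ (n + L)" by simp
    then show ?thesis by (simp add: power_add mult.commute)
  qed
  have offsets: "a (n + i + L) - a (n + L) = \<rho> ^ L * (a (n + i) - a n)" if "N \<le> n" for n i
  proof (induction i)
    case (Suc i)
    then show ?case using offset[of "n + i"] that by (simp add: right_diff_distrib)
  qed simp
  have left: "a (n + L) - x = \<rho> ^ L * (a n - x)" if "N \<le> n" for n
  proof -
    have lim: "a \<longlonglongrightarrow> x" unfolding a_def by (rule net_path_tendsto[OF P])
    have "(\<lambda>i. a (n + i + L) - a (n + L)) \<longlonglongrightarrow> x - a (n + L)"
      using LIMSEQ_ignore_initial_segment[OF lim, of "n + L"]
      by (intro tendsto_intros) (simp add: ac_simps)
    moreover have "(\<lambda>i. \<rho> ^ L * (a (n + i) - a n)) \<longlonglongrightarrow> \<rho> ^ L * (x - a n)"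
      using LIMSEQ_ignore_initial_segment[OF lim, of n]
      by (intro tendsto_intros) (simp add: ac_simps)
    ultimately have "x - a (n + L) = \<rho> ^ L * (x - a n)"
      unfolding offsets[OF that] by (rule LIMSEQ_unique)
    then show ?thesis by (simp add: algebra_simps)
  qed
  have right: "b (n + L) - x = \<rho> ^ L * (b n - x)" if "N \<le> n" for n
  proof -
    have "normalized_length (n + L) (\<Delta> (n + L)) = normalized_length n (\<Delta> n)"
      using per[OF that] net_pathD(4)[OF P, of n] net_pathD(4)[OF P, of "n + L"]
      by (simp add: char_vector_def)
    then have "(b (n + L) - a (n + L)) / \<rho> ^ (n + L) * \<rho> ^ (n + L) =
        (b n - a n) / \<rho> ^ n * \<rho> ^ (n + L)"
      by (simp add: normalized_length_def a_def b_def)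
    then have "b (n + L) - a (n + L) = \<rho> ^ L * (b n - a n)" by (simp add: power_add mult.commute)
    then show ?thesis using left[OF that] by (simp add: algebra_simps)
  qed
  have "a (N + k * L) - x = (\<rho> ^ L) ^ k * (a N - x) \<and> b (N + k * L) - x = (\<rho> ^ L) ^ k * (b N - x)"
  proof (induction k)
    case (Suc k)
    then show ?case using left[of "N + k * L"] right[of "N + k * L"]
      by (simp add: ac_simps)
  qed simp
  then show "fst (\<Delta> (N + k * L)) = x + (\<rho> ^ L) ^ k * (fst (\<Delta> N) - x)"
    "snd (\<Delta> (N + k * L)) = x + (\<rho> ^ L) ^ k * (snd (\<Delta> N) - x)"
    unfolding a_def b_def by (simp_all add: algebra_simps)
qed

text \<open>The sign \<open>e\<close> selects the side. At each level, a point of \<open>K\<close>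
  close enough to \<open>x\<close> on that side is interior to a net interval reaching back to
  \<open>x\<close>; the intervals of consecutive levels overlap near \<open>x\<close>, hence are
  parent and child.\<close>

lemma ex_one_sided_net_path:
  assumes e: "e = 1 \<or> e = (-1::real)" and acc: "\<And>\<delta>. 0 < \<delta> \<Longrightarrow> \<exists>t. 0 < t \<and> t < \<delta> \<and> x + e * t \<in> K"
  obtains s \<Delta> where "net_path x s \<Delta>"
    "\<And>n. \<exists>\<delta>>0. \<forall>t. 0 < t \<and> t < \<delta> \<longrightarrow> fst (\<Delta> n) < x + e * t \<and> x + e * t < snd (\<Delta> n)"
proof -
  let ?side = "\<lambda>n \<Delta>. \<exists>\<delta>>0. \<forall>t. 0 < t \<and> t < \<delta> \<longrightarrow> fst \<Delta> < x + e * t \<and> x + e * t < snd \<Delta>"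
  have "\<exists>\<Delta>. \<Delta> \<in> net_intervals n \<and> x \<in> ivl \<Delta> \<and> ?side n \<Delta>" for n
  proof -
    \<comment> \<open>No endpoint of level \<open>n\<close> other than \<open>x\<close> is closer to
      \<open>x\<close> than \<delta>, so the interval around \<open>x + e * t\<close> extends back
      to \<open>x\<close>.\<close>
    obtain \<delta> where \<delta>: "0 < \<delta>" "\<And>y. y \<in> endpoints n \<Longrightarrow> y \<noteq> x \<Longrightarrow> \<delta> \<le> dist x y"
      using finite_set_avoid[OF finite_endpoints] by metis
    obtain t where t: "0 < t" "t < \<delta>" "x + e * t \<in> K" using acc[OF \<delta>(1)] by blast
    have "x + e * t \<notin> endpoints n" using \<delta>(2)[of "x + e * t"] t e by (auto simp: dist_real_def)
    then obtain \<Delta> where \<Delta>: "\<Delta> \<in> net_intervals n" "fst \<Delta> < x + e * t" "x + e * t < snd \<Delta>"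
      using ex_net_interval t(3) by blast
    have "fst \<Delta> = x \<or> \<delta> \<le> \<bar>x - fst \<Delta>\<bar>" "snd \<Delta> = x \<or> \<delta> \<le> \<bar>x - snd \<Delta>\<bar>"
      using \<delta>(2) net_intervalD(1,2)[OF \<Delta>(1)] by (auto simp: dist_real_def)
    then have "x \<in> ivl \<Delta>" "\<forall>u. 0 < u \<and> u < t \<longrightarrow> fst \<Delta> < x + e * u \<and> x + e * u < snd \<Delta>"
      using \<Delta>(2,3) t(1,2) e by (auto simp: ivl_def)
    then show ?thesis using \<Delta>(1) t(1) by blast
  qed
  then obtain \<Delta> where \<Delta>: "\<And>n. \<Delta> n \<in> net_intervals n" "\<And>n. x \<in> ivl (\<Delta> n)" "\<And>n. ?side n (\<Delta> n)"
    by metis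
  have "parent n (\<Delta> n) (\<Delta> (Suc n))" for n
  proof -
    obtain \<delta> \<delta>' where d: "0 < \<delta>" "0 < \<delta>'"
      and s: "\<And>t. 0 < t \<and> t < \<delta> \<Longrightarrow> fst (\<Delta> n) < x + e * t \<and> x + e * t < snd (\<Delta> n)"
      and s': "\<And>t. 0 < t \<and> t < \<delta>' \<Longrightarrow> fst (\<Delta> (Suc n)) < x + e * t \<and> x + e * t < snd (\<Delta> (Suc n))"
      using \<Delta>(3)[of n] \<Delta>(3)[of "Suc n"] by blast
    define t where "t = min \<delta> \<delta>' / 2"
    have "0 < t \<and> t < \<delta>" "0 < t \<and> t < \<delta>'" using d by (auto simp: t_def)
    then show ?thesis
      using parent_if_overlap[OF \<Delta>(1)[of n] \<Delta>(1)[of "Suc n"], of "x + e * t"] s s' by blast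
  qed
  then have "net_path x (\<lambda>n. char_vector n (\<Delta> n)) \<Delta>" using \<Delta> by (simp add: net_path_def)
  then show thesis using that \<Delta>(3) by blast
qed

text \<open>\<open>N\<close> is the index where the periodic tail starts. The slices have one letter
  more than a period, so that they include the closing letter of the cycle.\<close>

lemma has_periodE:
  assumes "has_period s \<theta>"
  defines "L \<equiv> length (butlast \<theta>)"
  obtains N where "0 < L" "\<And>n. N \<le> n \<Longrightarrow> s (n + L) = s n"
    "\<And>k. map s [N + k * L..<Suc (N + k * L + L)] = \<theta>"
proof -
  obtain J where cyc: "admissible_cycle \<theta>"
    and J: "\<And>n. s (Suc J + n) = butlast \<theta> ! (n mod L)"
    using assms(1) by (auto simp: has_period_def L_def)
  have len: "length \<theta> = Suc L" and L: "0 < L" and hd: "hd \<theta> = last \<theta>"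
    using cyc by (auto simp: admissible_cycle_def L_def)
  have "s (n + L) = s n" if "Suc J \<le> n" for n
  proof -
    have "n + L = Suc J + (n - Suc J + L)" "n = Suc J + (n - Suc J)" using that by simp_all
    then show ?thesis using J[of "n - Suc J"] J[of "n - Suc J + L"] by (metis mod_add_self2)
  qed
  moreover have "map s [Suc J + k * L..<Suc (Suc J + k * L + L)] = \<theta>" for k
  proof (rule nth_equalityI)
    fix i assume "i < length (map s [Suc J + k * L..<Suc (Suc J + k * L + L)])"
    then have i: "i \<le> L" by (simp del: upt_Suc)
    have "map s [Suc J + k * L..<Suc (Suc J + k * L + L)] ! i = s (Suc J + (k * L + i))"
      using i by (subst nth_map) (auto simp: ac_simps simp del: upt_Suc)
    also have "\<dots> = butlast \<theta> ! (i mod L)" unfolding J by simp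
    also have "\<dots> = \<theta> ! i"
    \<comment> \<open>At the extra index the remainder wraps around to 0, and the cycle ends with
      its first letter.\<close>
    proof (cases "i = L")
      case True
      have "\<theta> \<noteq> []" using len by auto
      then have "\<theta> ! 0 = \<theta> ! L" using hd len by (simp add: hd_conv_nth last_conv_nth)
      then show ?thesis using True L len by (simp add: nth_butlast)
    next
      case False
      then show ?thesis using i len by (simp add: nth_butlast)
    qed
    finally show "map s [Suc J + k * L..<Suc (Suc J + k * L + L)] ! i = \<theta> ! i" .
  qed (simp add: len del: upt_Suc)
  ultimately show thesis using that[of "Suc J"] L by blast
qed

text \<open>Dimensions, propagation of the weights and nonnegativity share one induction, because
  associativity of the product requires the dimensions. \<open>n\<close> is generalized as the
  recursion of \<open>transition\<close> removes the first letter.\<close>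

lemma transition_net_path:
  assumes P: "net_path x s \<Delta>" and p: "\<And>j. j \<in> {0..m} \<Longrightarrow> 0 < p j"
  defines "M n \<equiv> length (neighbour_set n (\<Delta> n))"
  shows "transition p (map s [n..<Suc (n + i)]) \<in> carrier_mat (M n) (M (n + i)) \<and>
    neighbour_weights p n (\<Delta> n) * transition p (map s [n..<Suc (n + i)]) =
      neighbour_weights p (n + i) (\<Delta> (n + i)) \<and>
    (\<forall>j<M n. \<forall>k<M (n + i). 0 \<le> transition p (map s [n..<Suc (n + i)]) $$ (j, k))"
proof (induction i arbitrary: n)
  case 0
  have "neighbour_weights p n (\<Delta> n) \<in> carrier_mat 1 (M n)" by (simp add: M_def carrier_matI)
  then have "neighbour_weights p n (\<Delta> n) * 1\<^sub>m (M n) = neighbour_weights p n (\<Delta> n)"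
    by (rule right_mult_one_mat)
  moreover have "length (fst (snd (s n))) = M n"
    using net_pathD(4)[OF P, of n] by (simp add: char_vector_def M_def)
  ultimately show ?case by simp
next
  case (Suc i)
  define A where "A = primitive_transition p (s n) (s (Suc n))"
  define B where "B = transition p (map s [Suc n..<Suc (Suc n + i)])"
  have A_eq: "A = interval_transition p n (\<Delta> n) (\<Delta> (Suc n))"
    unfolding A_def by (rule primitive_transition_eq[OF net_pathD(5)[OF P]])
  \<comment> \<open>The first two letters are exposed so that the recursive equation of
    \<open>transition\<close> applies.\<close>
  have "[n..<Suc (n + Suc i)] = n # Suc n # [Suc (Suc n)..<Suc (Suc n + i)]"
    "[Suc n..<Suc (Suc n + i)] = Suc n # [Suc (Suc n)..<Suc (Suc n + i)]"
    by (simp_all add: upt_conv_Cons del: upt_Suc)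
  then have T: "transition p (map s [n..<Suc (n + Suc i)]) = A * B"
    unfolding A_def B_def by (simp del: upt_Suc)
  have A: "A \<in> carrier_mat (M n) (M (Suc n))" by (simp add: A_eq M_def carrier_matI)
  have B: "B \<in> carrier_mat (M (Suc n)) (M (n + Suc i))"
    and BW: "neighbour_weights p (Suc n) (\<Delta> (Suc n)) * B =
      neighbour_weights p (n + Suc i) (\<Delta> (n + Suc i))"
    and Bn: "\<And>j k. j < M (Suc n) \<Longrightarrow> k < M (n + Suc i) \<Longrightarrow> 0 \<le> B $$ (j, k)"
    using Suc.IH[of "Suc n"] by (auto simp: B_def simp del: upt_Suc)
  have W: "neighbour_weights p n (\<Delta> n) \<in> carrier_mat 1 (M n)" by (simp add: M_def carrier_matI)
  have "neighbour_weights p n (\<Delta> n) * (A * B) = neighbour_weights p n (\<Delta> n) * A * B"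
    by (rule assoc_mult_mat[OF W A B, symmetric])
  also have "neighbour_weights p n (\<Delta> n) * A = neighbour_weights p (Suc n) (\<Delta> (Suc n))"
    unfolding A_eq by (rule neighbour_weights_step[OF net_pathD(3)[OF P], symmetric])
  finally have "neighbour_weights p n (\<Delta> n) * (A * B) = neighbour_weights p (n + Suc i) (\<Delta> (n + Suc i))"
    using BW by simp
  moreover have "0 \<le> (A * B) $$ (j, k)" if "j < M n" "k < M (n + Suc i)" for j k
  proof -
    have "0 \<le> A $$ (j, l)" if "l < M (Suc n)" for l
      using interval_transition_entry[OF net_pathD(3)[OF P], of j n l p] \<open>j < M n\<close> that p
      unfolding A_eq M_def by (auto intro!: sum_nonneg simp: less_imp_le)
    then show ?thesis using that A B Bn
      by (auto simp: scalar_prod_def intro!: sum_nonneg mult_nonneg_nonneg)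
  qed
  ultimately show ?case unfolding T using A B by auto
qed

lemma neighbour_weights_pos:
  assumes p: "\<And>j. j \<in> {0..m} \<Longrightarrow> 0 < p j" and k: "k < length (neighbour_set n \<Delta>)"
  shows "0 < neighbour_weights p n \<Delta> $$ (0, k)"
proof -
  have "neighbour_set n \<Delta> ! k \<in> set (neighbour_set n \<Delta>)" using k by simp
  then have "{\<sigma> \<in> words n. S \<sigma> 0 = fst \<Delta> - \<rho> ^ n * neighbour_set n \<Delta> ! k} \<noteq> {}"
    unfolding mem_neighbour_set_iff by blast
  then have "0 < (\<Sum>\<sigma>\<in>{\<sigma> \<in> words n. S \<sigma> 0 = fst \<Delta> - \<rho> ^ n * neighbour_set n \<Delta> ! k}. weight p \<sigma>)"
    using weight_pos[of p, OF p] finite_words by (intro sum_pos) auto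
  then show ?thesis using k by (simp add: neighbour_weights_def)
qed

text \<open>Over \<open>k\<close> periods the weight vector is multiplied by
  \<open>T ^\<^sub>m k\<close>. The initial weights are positive and the powers nonnegative, so
  nothing cancels, and the total weight inherits both estimates for matrix powers.\<close>

lemma periodic_total_weight_bounds:
  assumes P: "net_path x s \<Delta>" and p: "\<And>j. j \<in> {0..m} \<Longrightarrow> 0 < p j" and L: "0 < L"
    and per: "\<And>n. N \<le> n \<Longrightarrow> s (n + L) = s n"
    and \<theta>: "\<And>k. map s [N + k * L..<Suc (N + k * L + L)] = \<theta>"
  shows "0 \<le> sp (transition p \<theta>)"
    and "\<exists>c>0. \<forall>k. c * sp (transition p \<theta>) ^ k \<le> total_weight p (N + k * L) (\<Delta> (N + k * L))"
    and "sp (transition p \<theta>) < t \<Longrightarrow> \<exists>C>0. \<forall>k. total_weight p (N + k * L) (\<Delta> (N + k * L)) \<le> C * t ^ k"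
proof -
  define T where "T = transition p \<theta>"
  define M where "M = length (neighbour_set N (\<Delta> N))"
  define q where "q i = neighbour_weights p N (\<Delta> N) $$ (0, i)" for i
  have M: "0 < M" unfolding M_def by (rule length_neighbour_set_pos[OF net_pathD(1)[OF P]])
  \<comment> \<open>Equal vectors have equally many neighbours, which makes \<open>T\<close> a
    square matrix.\<close>
  have len: "length (neighbour_set (N + k * L) (\<Delta> (N + k * L))) = M" for k
  proof (induction k)
    case (Suc k)
    then show ?case
      using per[of "N + k * L"] net_pathD(4)[OF P, of "N + k * L"] net_pathD(4)[OF P, of "N + k * L + L"]
      by (simp add: char_vector_def ac_simps)
  qed (simp add: M_def)
  have tr: "T \<in> carrier_mat M M \<and>
      neighbour_weights p (N + k * L) (\<Delta> (N + k * L)) * T =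
        neighbour_weights p (N + k * L + L) (\<Delta> (N + k * L + L)) \<and>
      (\<forall>i<M. \<forall>j<M. 0 \<le> T $$ (i, j))" for k
    using transition_net_path[OF P, of p "N + k * L" L] p len[of k] len[of "Suc k"]
    unfolding \<theta> T_def[symmetric] by (simp add: ac_simps)
  have T: "T \<in> carrier_mat M M" and Tn: "\<And>i j. i < M \<Longrightarrow> j < M \<Longrightarrow> 0 \<le> T $$ (i, j)"
    using tr[of 0] by auto
  have W: "neighbour_weights p (N + k * L) (\<Delta> (N + k * L)) = neighbour_weights p N (\<Delta> N) * T ^\<^sub>m k" for k
  proof (induction k)
    case 0
    have "neighbour_weights p N (\<Delta> N) \<in> carrier_mat 1 M" by (simp add: M_def carrier_matI)
    then show ?case using T right_mult_one_mat by fastforce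
  next
    case (Suc k)
    have C: "neighbour_weights p N (\<Delta> N) \<in> carrier_mat 1 M" by (simp add: M_def carrier_matI)
    have "neighbour_weights p (N + Suc k * L) (\<Delta> (N + Suc k * L)) =
        neighbour_weights p (N + k * L) (\<Delta> (N + k * L)) * T"
      using tr[of k] by (simp add: ac_simps)
    also have "\<dots> = neighbour_weights p N (\<Delta> N) * (T ^\<^sub>m k * T)"
      unfolding Suc by (rule assoc_mult_mat[OF C pow_carrier_mat[OF T] T])
    finally show ?case by simp
  qed
  have tw: "total_weight p (N + k * L) (\<Delta> (N + k * L)) = (\<Sum>j<M. \<Sum>i<M. q i * (T ^\<^sub>m k) $$ (i, j))" for k
  proof -
    have "total_weight p (N + k * L) (\<Delta> (N + k * L)) =
        (\<Sum>j<M. (neighbour_weights p N (\<Delta> N) * T ^\<^sub>m k) $$ (0, j))"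
      using total_weight_eq_sum[of p "N + k * L" "\<Delta> (N + k * L)"] by (simp only: len W)
    also have "\<dots> = (\<Sum>j<M. \<Sum>i<M. q i * (T ^\<^sub>m k) $$ (i, j))"
    proof (rule sum.cong[OF refl])
      fix j assume "j \<in> {..<M}"
      then show "(neighbour_weights p N (\<Delta> N) * T ^\<^sub>m k) $$ (0, j) = (\<Sum>i<M. q i * (T ^\<^sub>m k) $$ (i, j))"
        using carrier_matD[OF T]
        by (subst index_mult_mat(1)) (auto simp: scalar_prod_def q_def M_def lessThan_atLeast0 intro!: sum.cong)
    qed
    finally show ?thesis .
  qed
  have q: "0 < q i" if "i < M" for i
    using that unfolding q_def M_def by (intro neighbour_weights_pos p)
  have Tk: "0 \<le> (T ^\<^sub>m k) $$ (i, j)" if "i < M" "j < M" for i j k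
    by (rule pow_mat_nonneg[OF T Tn that])
  show "0 \<le> sp (transition p \<theta>)" using sp_nonneg[OF T M] by (simp add: T_def)
  show "\<exists>c>0. \<forall>k. c * sp (transition p \<theta>) ^ k \<le> total_weight p (N + k * L) (\<Delta> (N + k * L))"
  proof -
    obtain c i where c: "0 < c" "i < M" "\<And>k. c * sp T ^ k \<le> (\<Sum>j<M. \<bar>(T ^\<^sub>m k) $$ (i, j)\<bar>)"
      using sp_power_le_pow_mat_row_sum[OF T M] by blast
    \<comment> \<open>The one row in which the powers are large, weighted by the positive number
      \<open>q i\<close>, already gives the lower bound.\<close>
    have "(q i * c) * sp T ^ k \<le> total_weight p (N + k * L) (\<Delta> (N + k * L))" for k
    proof -
      have "(q i * c) * sp T ^ k \<le> q i * (\<Sum>j<M. \<bar>(T ^\<^sub>m k) $$ (i, j)\<bar>)"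
        using c(3)[of k] q[OF c(2)] by (simp add: mult.assoc mult_left_mono)
      also have "\<dots> = (\<Sum>j<M. q i * (T ^\<^sub>m k) $$ (i, j))"
        using Tk[OF c(2)] by (simp add: sum_distrib_left)
      also have "\<dots> \<le> (\<Sum>j<M. \<Sum>i<M. q i * (T ^\<^sub>m k) $$ (i, j))"
      proof (rule sum_mono)
        fix j assume "j \<in> {..<M}"
        then show "q i * (T ^\<^sub>m k) $$ (i, j) \<le> (\<Sum>i<M. q i * (T ^\<^sub>m k) $$ (i, j))"
          using c(2) q Tk by (intro member_le_sum) (auto intro!: mult_nonneg_nonneg simp: less_imp_le)
      qed
      finally show ?thesis unfolding tw .
    qed
    moreover have "0 < q i * c" using c q by simp
    ultimately show ?thesis unfolding T_def by blast
  qed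
  assume t: "sp (transition p \<theta>) < t"
  then have t0: "0 < t" using sp_nonneg[OF T M] by (simp add: T_def)
  obtain C where C: "0 < C" "\<And>k i j. i < M \<Longrightarrow> j < M \<Longrightarrow> \<bar>(T ^\<^sub>m k) $$ (i, j)\<bar> \<le> C * t ^ k"
    using pow_mat_entries_le_sp_power[OF T M t[folded T_def]] by blast
  define D where "D = (\<Sum>j<M. \<Sum>i<M. q i * C)"
  have "total_weight p (N + k * L) (\<Delta> (N + k * L)) \<le> D * t ^ k" for k
  proof -
    have "(T ^\<^sub>m k) $$ (i, j) \<le> C * t ^ k" if "i < M" "j < M" for i j
      using C(2)[OF that, of k] by simp
    then have "total_weight p (N + k * L) (\<Delta> (N + k * L)) \<le> (\<Sum>j<M. \<Sum>i<M. q i * (C * t ^ k))"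
      unfolding tw using q by (intro sum_mono mult_left_mono) (auto simp: less_imp_le)
    then show ?thesis by (simp add: D_def sum_distrib_right mult.assoc)
  qed
  moreover have "0 < D" unfolding D_def using M q C(1) by (intro sum_pos) auto
  ultimately show "\<exists>C>0. \<forall>k. total_weight p (N + k * L) (\<Delta> (N + k * L)) \<le> C * t ^ k" by blast
qed

text \<open>A single covering word already has weight at least \<open>c ^ n\<close>. The bound
  serves to exclude spectral radius zero.\<close>

lemma power_le_total_weight:
  assumes p: "\<And>j. j \<in> {0..m} \<Longrightarrow> c \<le> p j" and c: "0 < c" and \<Delta>: "\<Delta> \<in> net_intervals n"
  shows "c ^ n \<le> total_weight p n \<Delta>"
proof -
  have pos: "0 < p j" if "j \<in> {0..m}" for j using p[OF that] c by linarith
  obtain \<sigma> where \<sigma>: "\<sigma> \<in> words n" "ivl \<Delta> \<subseteq> S \<sigma> ` {0..1}" using neighbour_set_nonempty[OF \<Delta>] .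
  have "c ^ length \<sigma> \<le> weight p \<sigma>" if "set \<sigma> \<subseteq> {0..m}"
    using that
  proof (induction \<sigma>)
    case (Cons j \<sigma>)
    then have "c * c ^ length \<sigma> \<le> p j * weight p \<sigma>" 
      using p c pos[of j] by (intro mult_mono) (auto intro: less_imp_le)
    then show ?case by (simp add: weight_def)
  qed (simp add: weight_def)
  then have "c ^ n \<le> weight p \<sigma>" using \<sigma>(1) by (auto simp: words_def)
  also have "\<dots> \<le> total_weight p n \<Delta>"
    unfolding total_weight_def using \<sigma> weight_pos[of p _ n] pos finite_words
    by (intro member_le_sum) (auto intro: less_imp_le)
  finally show ?thesis .
qed

text \<open>With spectral radius zero the total weight would decay faster than every geometric
  sequence, against the lower bound by powers of the least probability. Positivity gives the
  logarithm in the dimension formula its meaning.\<close>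

lemma sp_transition_pos:
  assumes P: "net_path x s \<Delta>" and p: "\<And>j. j \<in> {0..m} \<Longrightarrow> 0 < p j" and L: "0 < L"
    and per: "\<And>n. N \<le> n \<Longrightarrow> s (n + L) = s n"
    and \<theta>: "\<And>k. map s [N + k * L..<Suc (N + k * L + L)] = \<theta>"
  shows "0 < sp (transition p \<theta>)"
proof (rule ccontr)
  assume "\<not> 0 < sp (transition p \<theta>)"
  define c where "c = Min (p ` {0..m})"
  have c: "0 < c" "\<And>j. j \<in> {0..m} \<Longrightarrow> c \<le> p j" unfolding c_def using p by auto
  \<comment> \<open>Half the rate per period of the lower bound \<open>c ^ (N + k * L)\<close>; the
    resulting factor \<open>2 ^ k\<close> eventually beats the constants.\<close>
  define t where "t = c ^ L / 2"
  have t: "0 < t" using c by (simp add: t_def)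
  with \<open>\<not> _\<close> obtain C where C: "0 < C" "\<And>k. total_weight p (N + k * L) (\<Delta> (N + k * L)) \<le> C * t ^ k"
    using periodic_total_weight_bounds(3)[of x s \<Delta> p L N \<theta> t, OF P p L per \<theta>] by auto
  obtain k where k: "C / c ^ N < 2 ^ k" using real_arch_pow[of 2 "C / c ^ N"] by auto
  have "c ^ N * (2 ^ k * t ^ k) = c ^ (N + k * L)"
    by (simp add: t_def power_add power_divide power_mult[symmetric] mult.commute)
  also have "\<dots> \<le> C * t ^ k"
    using power_le_total_weight[OF c(2,1) net_pathD(1)[OF P]] C(2)[of k] by (meson order_trans)
  finally have "c ^ N * 2 ^ k \<le> C" using t by (simp add: mult.assoc[symmetric])
  then show False using k c(1) by (simp add: divide_less_eq mult.commute)
qed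

end

section \<open>Measure of net intervals and balls\<close>

context self_similar_measure
begin

section \<open>Iterated self-similarity and the support of the measure\<close>

lemma space_mu: "space \<mu> = UNIV"
  using sets_eq_imp_space_eq[OF sets_mu] by simp

lemma borel_S_vimage:
  assumes "A \<in> sets borel" "\<sigma> \<in> words n"
  shows "S \<sigma> -` A \<in> sets borel"
proof -
  have "S \<sigma> = (\<lambda>x. S \<sigma> 0 + \<rho> ^ n * x)" using S_affine[OF assms(2)] by blast
  also have "\<dots> \<in> borel_measurable borel" by measurable
  finally show ?thesis using measurable_sets[of "S \<sigma>" borel borel A] assms(1) by simp
qed

lemma mu_words:
  assumes "A \<in> sets borel"
  shows "measure \<mu> A = (\<Sum>\<sigma>\<in>words n. weight p \<sigma> * measure \<mu> (S \<sigma> -` A))"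
proof (induction n)
  case 0
  have "words 0 = {[]}" by (auto simp: words_def)
  moreover have "S [] -` A = A" by (auto simp: S_def)
  ultimately show ?case by (simp add: weight_def)
next
  case (Suc n)
  have "weight p \<sigma> * measure \<mu> (S \<sigma> -` A) =
      (\<Sum>l\<in>{0..m}. weight p (\<sigma> @ [l]) * measure \<mu> (S (\<sigma> @ [l]) -` A))" if "\<sigma> \<in> words n" for \<sigma>
  proof -
    have "S (\<sigma> @ [l]) -` A = sim \<rho> d l -` (S \<sigma> -` A)" for l by (auto simp: S_def)
    then show ?thesis
      unfolding mu_self_similar[OF borel_S_vimage[OF assms that]]
      by (simp add: sum_distrib_left weight_snoc mult.assoc)
  qed
  then show ?case unfolding Suc sum_words_Suc by (rule sum.cong[OF refl])
qed

text \<open>Every map multiplies the distance to \<open>K\<close> by at most \<rho>. By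
  self-similarity the mass beyond distance \<open>t\<close> is then at most the mass beyond
  \<open>t / \<rho> ^ n\<close> for all \<open>n\<close>, and these sets decrease to the empty
  set.\<close>

lemma mu_far_from_K:
  assumes t: "0 < t"
  shows "measure \<mu> {y. t < infdist y K} = 0"
proof -
  interpret prob_space \<mu> by (rule mu_prob)
  define f where "f t = measure \<mu> {y. t < infdist y K}" for t
  have borel: "{y. t < infdist y K} \<in> sets borel" for t
    by (intro borel_open open_Collect_less continuous_intros)
  have f_step: "f t \<le> f (t / \<rho>)" for t
  proof -
    have sub: "sim \<rho> d j -` {y. t < infdist y K} \<subseteq> {y. t / \<rho> < infdist y K}" if j: "j \<in> {0..m}" for j
    proof
      fix y assume "y \<in> sim \<rho> d j -` {y. t < infdist y K}"
      then have y: "t < infdist (\<rho> * y + d j) K" by (simp add: sim_def)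
      \<comment> \<open>The image of a nearest point of \<open>K\<close> lies again in
        \<open>K\<close>, which bounds the distance of the image of \<open>y\<close>.\<close>
      obtain z where z: "z \<in> K" "infdist y K = dist y z"
        using infdist_attains_inf[OF compact_imp_closed[OF K_compact] K_nonempty] by blast
      have "infdist (\<rho> * y + d j) K \<le> dist (\<rho> * y + d j) (\<rho> * z + d j)"
        using infdist_le[OF sim_in_K[OF j z(1)]] .
      also have "\<dots> = \<rho> * infdist y K"
        using rho_pos unfolding z(2) dist_real_def
        by (simp add: abs_mult[symmetric] right_diff_distrib[symmetric] abs_mult_pos')
      finally show "y \<in> {y. t / \<rho> < infdist y K}" using y rho_pos by (simp add: divide_less_eq mult.commute)
    qed
    have "f t = (\<Sum>j\<in>{0..m}. p j * measure \<mu> (sim \<rho> d j -` {y. t < infdist y K}))"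
      unfolding f_def by (rule mu_self_similar[OF borel])
    also have "\<dots> \<le> (\<Sum>j\<in>{0..m}. p j * f (t / \<rho>))"
      unfolding f_def using p_pos sub borel sets_mu
      by (intro sum_mono mult_left_mono finite_measure_mono) (auto intro: less_imp_le)
    also have "\<dots> = f (t / \<rho>)" using p_sum by (simp add: sum_distrib_right[symmetric])
    finally show ?thesis .
  qed
  have f_le: "f t \<le> f (t / \<rho> ^ n)" for n
  proof (induction n)
    case (Suc n)
    have "f (t / \<rho> ^ n) \<le> f (t / \<rho> ^ Suc n)"
      using f_step[of "t / \<rho> ^ n"] by (simp add: mult.commute)
    with Suc show ?case by linarith
  qed simp
  have "(\<lambda>n. measure \<mu> {y. t / \<rho> ^ n < infdist y K}) \<longlonglongrightarrow> measure \<mu> (\<Inter>n. {y. t / \<rho> ^ n < infdist y K})"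
  proof (rule finite_Lim_measure_decseq)
    show "decseq (\<lambda>n. {y. t / \<rho> ^ n < infdist y K})"
    proof (rule decseq_SucI, rule subsetI)
      fix n y assume "y \<in> {y. t / \<rho> ^ Suc n < infdist y K}"
      moreover have "t / \<rho> ^ n \<le> t / \<rho> ^ Suc n"
        using t rho_pos rho_less_1 by (intro divide_left_mono) auto
      ultimately show "y \<in> {y. t / \<rho> ^ n < infdist y K}" by simp
    qed
  qed (use borel sets_mu in auto)
  moreover have "(\<Inter>n. {y. t / \<rho> ^ n < infdist y K}) = {}"
  proof (rule ccontr)
    assume "(\<Inter>n. {y. t / \<rho> ^ n < infdist y K}) \<noteq> {}"
    then obtain y where y: "\<And>n. t / \<rho> ^ n < infdist y K" by auto
    have D: "0 < infdist y K + 1" using infdist_nonneg[of y K] by linarith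
    obtain n where "\<rho> ^ n < t / (infdist y K + 1)"
      using real_arch_pow_inv[OF _ rho_less_1, of "t / (infdist y K + 1)"] t D by auto
    then have "infdist y K + 1 < t / \<rho> ^ n" using D rho_power_pos[of n] by (simp add: field_simps)
    with y[of n] show False by simp
  qed
  ultimately have "(\<lambda>n. f (t / \<rho> ^ n)) \<longlonglongrightarrow> 0" by (simp add: f_def)
  then have "f t \<le> 0" by (rule LIMSEQ_le_const) (use f_le in blast)
  then show ?thesis unfolding f_def using measure_nonneg by (simp add: order_antisym)
qed

text \<open>\<open>K\<close> is closed, so its complement is a countable union of sets at positive
  distance from \<open>K\<close>, each of them null.\<close>

lemma mu_null_if_disjoint_K:
  assumes "A \<inter> K = {}" "A \<in> sets borel"
  shows "measure \<mu> A = 0"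
proof -
  interpret prob_space \<mu> by (rule mu_prob)
  have borel: "{y. t < infdist y K} \<in> sets borel" for t
    by (intro borel_open open_Collect_less continuous_intros)
  have "(\<Union>n. {y. 1 / real (Suc n) < infdist y K}) \<in> null_sets \<mu>"
  proof (rule null_sets_UN)
    fix n :: nat
    have "measure \<mu> {y. 1 / real (Suc n) < infdist y K} = 0" by (rule mu_far_from_K) simp
    then show "{y. 1 / real (Suc n) < infdist y K} \<in> null_sets \<mu>"
      using borel sets_mu by (simp add: null_sets_def emeasure_eq_measure)
  qed
  moreover have "A \<subseteq> (\<Union>n. {y. 1 / real (Suc n) < infdist y K})"
  proof
    fix y assume "y \<in> A"
    then have "y \<notin> K" using assms(1) by blast
    then have "0 < infdist y K"
      using infdist_pos_not_in_closed[OF compact_imp_closed[OF K_compact] K_nonempty] by blast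
    from nat_approx_posE[OF this] obtain n where "1 / real (Suc n) < infdist y K" by blast
    then show "y \<in> (\<Union>n. {y. 1 / real (Suc n) < infdist y K})" by blast
  qed
  ultimately have "A \<in> null_sets \<mu>" using assms(2) sets_mu null_sets_subset by blast
  then show ?thesis by (simp add: measure_def null_sets_def)
qed

lemma mu_outside_unit: "A \<inter> {0..1} = {} \<Longrightarrow> A \<in> sets borel \<Longrightarrow> measure \<mu> A = 0"
  using K_subset by (intro mu_null_if_disjoint_K) auto

lemma mu_superset_unit:
  assumes "{0..1} \<subseteq> A" "A \<in> sets borel"
  shows "measure \<mu> A = 1"
proof -
  interpret prob_space \<mu> by (rule mu_prob)
  have "prob (space \<mu> - A) = 0"
    unfolding space_mu by (rule mu_outside_unit) (use assms in auto)
  then show ?thesis using prob_compl[of A] assms(2) sets_mu by simp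
qed

text \<open>In the self-similarity equation for the singleton only the map fixing \<open>a\<close>
  contributes, so the mass equals \<open>p j\<close> times itself with
  \<open>p j < 1\<close>.\<close>

lemma mu_singleton_end:
  assumes j: "j \<in> {0..m}" and fixed: "\<rho> * a + d j = a"
    and out: "\<And>l. l \<in> {0..m} \<Longrightarrow> l \<noteq> j \<Longrightarrow> (a - d l) / \<rho> \<notin> {0..1}"
  shows "measure \<mu> {a} = 0"
proof -
  have vim: "sim \<rho> d l -` {a} = {(a - d l) / \<rho>}" for l
    using rho_pos by (auto simp: sim_def field_simps)
  have "(a - d j) / \<rho> = a" using fixed rho_pos by (simp add: field_simps)
  have "measure \<mu> {a} = (\<Sum>l\<in>{0..m}. p l * measure \<mu> {(a - d l) / \<rho>})"
    using mu_self_similar[of "{a}"] by (simp add: vim)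
  also have "\<dots> = (\<Sum>l\<in>{0..m}. if l = j then p j * measure \<mu> {a} else 0)"
  proof (intro sum.cong refl)
    fix l assume l: "l \<in> {0..m}"
    show "p l * measure \<mu> {(a - d l) / \<rho>} = (if l = j then p j * measure \<mu> {a} else 0)"
      using mu_outside_unit[of "{(a - d l) / \<rho>}"] out[OF l] \<open>(a - d j) / \<rho> = a\<close> by auto
  qed
  also have "\<dots> = p j * measure \<mu> {a}" using j by simp
  finally have eq: "(1 - p j) * measure \<mu> {a} = 0" by (simp add: algebra_simps)
  \<comment> \<open>There are at least two letters, so \<open>p j\<close> is smaller than the total
    1.\<close>
  obtain i where i: "i \<in> {0..m}" "i \<noteq> j"
    using m_ge_1 j by (metis atLeastAtMost_iff le0 not_one_le_zero order_refl)
  have "p j + p i = (\<Sum>l\<in>{j, i}. p l)" using i by simp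
  also have "\<dots> \<le> (\<Sum>l\<in>{0..m}. p l)"
    using i j p_pos by (intro sum_mono2) (auto intro: less_imp_le)
  finally have "p j < 1" using p_pos[OF i(1)] p_sum by simp
  with eq show ?thesis by simp
qed

text \<open>0 and 1 are the fixed points of the first and the last map. That they are null allows
  images touching a net interval only at an end to be ignored.\<close>

lemma mu_zero: "measure \<mu> {0} = 0" and mu_one: "measure \<mu> {1} = 0"
proof -
  show "measure \<mu> {0} = 0"
  proof (rule mu_singleton_end)
    fix l assume "l \<in> {0..m}" "l \<noteq> 0"
    then have "0 < d l / \<rho>" using d_pos rho_pos by simp
    then show "(0 - d l) / \<rho> \<notin> {0..1}" by simp
  qed (simp_all add: d_0)
  show "measure \<mu> {1} = 0"
  proof (rule mu_singleton_end)
    fix l assume l: "l \<in> {0..m}" "l \<noteq> m"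
    then have "d l < d m" using strict_mono_onD[OF d_strict_mono, of l m] by auto
    then have "\<rho> < 1 - d l" using d_top by linarith
    then show "(1 - d l) / \<rho> \<notin> {0..1}" using rho_pos by (simp add: field_simps)
  qed (use d_top in simp_all)
qed

text \<open>An image that does not cover the net interval meets it at most in the ends of the image,
  so the preimage of the net interval avoids the open unit interval and is null.\<close>

lemma mu_net_interval_le:
  assumes \<Delta>: "\<Delta> \<in> net_intervals n"
  shows "measure \<mu> (ivl \<Delta>) \<le> total_weight p n \<Delta>"
proof -
  interpret prob_space \<mu> by (rule mu_prob)
  have borel: "ivl \<Delta> \<in> sets borel" by (simp add: ivl_def)
  have "measure \<mu> (ivl \<Delta>) = (\<Sum>\<sigma>\<in>words n. weight p \<sigma> * measure \<mu> (S \<sigma> -` ivl \<Delta>))"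
    by (rule mu_words[OF borel])
  also have "\<dots> \<le> (\<Sum>\<sigma>\<in>words n. if ivl \<Delta> \<subseteq> S \<sigma> ` {0..1} then weight p \<sigma> else 0)"
  proof (rule sum_mono)
    fix \<sigma> assume \<sigma>: "\<sigma> \<in> words n"
    have w: "0 < weight p \<sigma>" by (rule weight_pos[OF p_pos \<sigma>])
    show "weight p \<sigma> * measure \<mu> (S \<sigma> -` ivl \<Delta>) \<le> (if ivl \<Delta> \<subseteq> S \<sigma> ` {0..1} then weight p \<sigma> else 0)"
    proof (cases "ivl \<Delta> \<subseteq> S \<sigma> ` {0..1}")
      case True
      then show ?thesis using w by (simp add: mult_left_le)
    next
      case False
      have "S \<sigma> -` ivl \<Delta> \<subseteq> (- {0..1}) \<union> ({0} \<union> {1})"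
      proof
        fix y assume y: "y \<in> S \<sigma> -` ivl \<Delta>"
        show "y \<in> (- {0..1}) \<union> ({0} \<union> {1})"
        proof (rule ccontr)
          assume "y \<notin> (- {0..1}) \<union> ({0} \<union> {1})"
          then have "0 < y" "y < 1" by auto
          then have "0 < \<rho> ^ n * y" "\<rho> ^ n * y < \<rho> ^ n * 1"
            using rho_power_pos[of n] by (simp_all only: mult_less_cancel_left_pos mult_pos_pos)
          then have "S \<sigma> 0 < S \<sigma> y" "S \<sigma> y < S \<sigma> 0 + \<rho> ^ n"
            using S_affine[OF \<sigma>, of y] by auto
          moreover have "fst \<Delta> \<le> S \<sigma> y" "S \<sigma> y \<le> snd \<Delta>" using y by (auto simp: ivl_def)
          moreover have "S \<sigma> 0 \<in> endpoints n" "S \<sigma> 0 + \<rho> ^ n \<in> endpoints n"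
            using \<sigma> by (auto simp: endpoints_iff)
          then have "S \<sigma> 0 \<le> fst \<Delta> \<or> snd \<Delta> \<le> S \<sigma> 0"
            "S \<sigma> 0 + \<rho> ^ n \<le> fst \<Delta> \<or> snd \<Delta> \<le> S \<sigma> 0 + \<rho> ^ n"
            using net_intervalD(4)[OF \<Delta>] by blast+
          ultimately have "ivl \<Delta> \<subseteq> S \<sigma> ` {0..1}" by (auto simp: S_image_unit[OF \<sigma>] ivl_def)
          with False show False by blast
        qed
      qed
      then have "measure \<mu> (S \<sigma> -` ivl \<Delta>) \<le> measure \<mu> ((- {0..1}) \<union> ({0} \<union> {1}))"
        using sets_mu by (intro finite_measure_mono) auto
      also have "\<dots> \<le> measure \<mu> (- {0..1}) + measure \<mu> ({0} \<union> {1})"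
        using sets_mu by (intro measure_Un_le) auto
      also have "\<dots> \<le> measure \<mu> (- {0..1}) + (measure \<mu> {0} + measure \<mu> {1})"
        using sets_mu by (intro add_left_mono measure_Un_le) auto
      also have "\<dots> = 0" using mu_outside_unit[of "- {0..1}"] mu_zero mu_one by auto
      finally show ?thesis using False by (simp add: measure_le_0_iff)
    qed
  qed
  also have "\<dots> = total_weight p n \<Delta>" by (simp add: total_weight_def sum_words_filter)
  finally show ?thesis .
qed

text \<open>A covering image has length \<open>\<rho> ^ n\<close> and contains \<open>x\<close>,
  hence lies in the ball; the preimage of the ball then contains the unit interval and has full
  mass.\<close>

lemma total_weight_le_mu_ball:
  assumes "x \<in> ivl \<Delta>"
  shows "total_weight p n \<Delta> \<le> measure \<mu> {x - \<rho> ^ n..x + \<rho> ^ n}"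
proof -
  have "total_weight p n \<Delta> = (\<Sum>\<sigma>\<in>words n. if ivl \<Delta> \<subseteq> S \<sigma> ` {0..1} then weight p \<sigma> else 0)"
    by (simp add: total_weight_def sum_words_filter)
  also have "\<dots> \<le> (\<Sum>\<sigma>\<in>words n. weight p \<sigma> * measure \<mu> (S \<sigma> -` {x - \<rho> ^ n..x + \<rho> ^ n}))"
  proof (rule sum_mono)
    fix \<sigma> assume \<sigma>: "\<sigma> \<in> words n"
    have w: "0 < weight p \<sigma>" by (rule weight_pos[OF p_pos \<sigma>])
    show "(if ivl \<Delta> \<subseteq> S \<sigma> ` {0..1} then weight p \<sigma> else 0) \<le>
      weight p \<sigma> * measure \<mu> (S \<sigma> -` {x - \<rho> ^ n..x + \<rho> ^ n})"
    proof (cases "ivl \<Delta> \<subseteq> S \<sigma> ` {0..1}")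
      case True
      then have "x \<in> S \<sigma> ` {0..1}" using assms by blast
      then have "S \<sigma> ` {0..1} \<subseteq> {x - \<rho> ^ n..x + \<rho> ^ n}" by (auto simp: S_image_unit[OF \<sigma>])
      then have "measure \<mu> (S \<sigma> -` {x - \<rho> ^ n..x + \<rho> ^ n}) = 1"
        using borel_S_vimage[OF _ \<sigma>] by (intro mu_superset_unit) auto
      then show ?thesis using w by simp
    qed (use w in \<open>simp add: measure_nonneg\<close>)
  qed
  also have "\<dots> = measure \<mu> {x - \<rho> ^ n..x + \<rho> ^ n}" by (rule mu_words[symmetric]) simp
  finally show ?thesis .
qed

text \<open>By self-similarity of the path, a one-sided neighbourhood of \<open>x\<close> at level
  \<open>N\<close>, shrunk by \<open>\<rho> ^ L\<close> per period, stays inside the later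
  intervals, whose measure is at most their total weight.\<close>

lemma one_sided_measure_bound:
  assumes P: "net_path x s \<Delta>"
    and side: "\<exists>\<delta>>0. \<forall>u. 0 < u \<and> u < \<delta> \<longrightarrow> fst (\<Delta> N) < x + e * u \<and> x + e * u < snd (\<Delta> N)"
    and t: "sp (transition p \<theta>) < t"
    and N: "\<And>n. N \<le> n \<Longrightarrow> s (n + length (butlast \<theta>)) = s n"
      "\<And>k. map s [N + k * length (butlast \<theta>)..<Suc (N + k * length (butlast \<theta>) + length (butlast \<theta>))] = \<theta>"
      "0 < length (butlast \<theta>)"
  shows "\<exists>B>0. \<exists>C>0. \<forall>k. measure \<mu> ((\<lambda>u. x + e * u) ` {0..B * (\<rho> ^ length (butlast \<theta>)) ^ k}) \<le> C * t ^ k"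
proof -
  interpret prob_space \<mu> by (rule mu_prob)
  define L where "L = length (butlast \<theta>)"
  define R where "R = \<rho> ^ L"
  have R: "0 < R" unfolding R_def by (rule rho_power_pos)
  obtain \<delta> where \<delta>: "0 < \<delta>"
    "\<And>u. 0 < u \<and> u < \<delta> \<Longrightarrow> fst (\<Delta> N) < x + e * u \<and> x + e * u < snd (\<Delta> N)"
    using side by blast
  obtain C where C: "0 < C" "\<And>k. total_weight p (N + k * L) (\<Delta> (N + k * L)) \<le> C * t ^ k"
    using periodic_total_weight_bounds(3)[of x s \<Delta> p L N \<theta> t, OF P p_pos _ _ _ t] N
    unfolding L_def by blast
  have "measure \<mu> ((\<lambda>u. x + e * u) ` {0..\<delta> / 2 * R ^ k}) \<le> C * t ^ k" for k
  proof -
    have "(\<lambda>u. x + e * u) ` {0..\<delta> / 2 * R ^ k} \<subseteq> ivl (\<Delta> (N + k * L))"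
    proof
      fix y assume "y \<in> (\<lambda>u. x + e * u) ` {0..\<delta> / 2 * R ^ k}"
      then obtain u where u: "0 \<le> u" "u \<le> \<delta> / 2 * R ^ k" "y = x + e * u" by auto
      \<comment> \<open>The parameter rescaled back to level \<open>N\<close>; halving \<delta>
        keeps it strictly inside the range of \<open>side\<close>.\<close>
      define v where "v = u / R ^ k"
      have v: "0 \<le> v" "v \<le> \<delta> / 2" "u = R ^ k * v" using u R by (auto simp: v_def field_simps)
      \<comment> \<open>For \<open>v = 0\<close> the point is \<open>x\<close> itself, possibly an
        end of the interval.\<close>
      have "fst (\<Delta> N) \<le> x + e * v" "x + e * v \<le> snd (\<Delta> N)"
        using \<delta>(2)[of v] v \<delta>(1) net_pathD(2)[OF P, of N] by (cases "v = 0"; auto simp: ivl_def)+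
      then have "R ^ k * (fst (\<Delta> N) - x) \<le> R ^ k * (e * v)" "R ^ k * (e * v) \<le> R ^ k * (snd (\<Delta> N) - x)"
        using R by (auto intro!: mult_left_mono)
      then show "y \<in> ivl (\<Delta> (N + k * L))"
        using net_path_self_similar[OF P N(1), of N k, folded L_def R_def] N(1)[folded L_def]
        by (simp add: ivl_def u(3) v(3) ac_simps)
    qed
    then have "measure \<mu> ((\<lambda>u. x + e * u) ` {0..\<delta> / 2 * R ^ k}) \<le> measure \<mu> (ivl (\<Delta> (N + k * L)))"
      using sets_mu by (intro finite_measure_mono) (auto simp: ivl_def)
    also have "\<dots> \<le> total_weight p (N + k * L) (\<Delta> (N + k * L))"
      by (rule mu_net_interval_le[OF net_pathD(1)[OF P]])
    finally show ?thesis using C(2)[of k] by linarith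
  qed
  then show ?thesis using \<delta>(1) C(1) unfolding R_def L_def
    by (intro exI[of _ "\<delta> / 2"] conjI exI[of _ C]) auto
qed

text \<open>The lower bound uses the path of \<open>s\<close> alone, the upper bound treats the two
  sides of \<open>x\<close> separately. Equal period lengths in \<open>other\<close> give both
  representations the same contraction \<open>R\<close>, so that their spectral radii can be
  compared.\<close>

lemma has_local_dim_periodic_point:
  assumes rep: "symbolic_rep x s" and per: "has_period s \<theta>"
    and other: "\<And>s'. boundary_point x \<Longrightarrow> symbolic_rep x s' \<Longrightarrow> s' \<noteq> s \<Longrightarrow>
      has_period s' \<phi> \<and> length \<phi> = length \<theta> \<and> sp (transition p \<phi>) \<le> sp (transition p \<theta>)"
  shows "has_local_dim \<mu> x
    (ln (sp (transition p \<theta>)) / (real (length (butlast \<theta>)) * ln \<rho>))"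
proof -
  interpret prob_space \<mu> by (rule mu_prob)
  define L where "L = length (butlast \<theta>)"
  define R where "R = \<rho> ^ L"
  define \<tau> where "\<tau> = sp (transition p \<theta>)"
  define f where "f r = measure \<mu> {x - r..x + r}" for r
  obtain \<Delta> where P: "net_path x s \<Delta>" using rep symbolic_rep_iff by blast
  obtain N where L: "0 < L" and N: "\<And>n. N \<le> n \<Longrightarrow> s (n + L) = s n"
    "\<And>k. map s [N + k * L..<Suc (N + k * L + L)] = \<theta>"
    using has_periodE[OF per] unfolding L_def by blast
  have R: "0 < R" "R < 1"
    unfolding R_def using rho_pos rho_less_1 L by (auto intro: power_less_one_iff[THEN iffD2] simp: power_less_one_iff)
  obtain c where c: "0 < c" "\<And>k. c * \<tau> ^ k \<le> total_weight p (N + k * L) (\<Delta> (N + k * L))"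
    using periodic_total_weight_bounds(2)[of x s \<Delta> p L N \<theta>, OF P p_pos L N]
    unfolding \<tau>_def by blast
  have low: "c * \<tau> ^ k \<le> f (\<rho> ^ N * R ^ k)" for k
  proof -
    have "\<rho> ^ (N + k * L) = \<rho> ^ N * R ^ k" by (simp add: R_def power_add power_mult[symmetric] mult.commute)
    then show ?thesis
      using c(2)[of k] total_weight_le_mu_ball[OF net_pathD(2)[OF P], of "N + k * L" "N + k * L"]
      by (simp add: f_def)
  qed
  \<comment> \<open>\<open>e = 1\<close> stands for the right side of \<open>x\<close> and
    \<open>e = -1\<close> for the left side.\<close>
  have side: "\<exists>B>0. \<exists>C>0. \<forall>k. measure \<mu> ((\<lambda>u. x + e * u) ` {0..B * R ^ k}) \<le> C * t ^ k"
    if e: "e = 1 \<or> e = (-1::real)" and t: "\<tau> < t" for e t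
  proof (cases "\<forall>\<delta>>0. \<exists>u. 0 < u \<and> u < \<delta> \<and> x + e * u \<in> K")
    case True
    then obtain s' \<Delta>' where P': "net_path x s' \<Delta>'"
      and sd: "\<And>n. \<exists>\<delta>>0. \<forall>u. 0 < u \<and> u < \<delta> \<longrightarrow> fst (\<Delta>' n) < x + e * u \<and> x + e * u < snd (\<Delta>' n)"
      using ex_one_sided_net_path[OF e] by metis
    \<comment> \<open>If the one-sided path does not represent \<open>s\<close>, then
      \<open>x\<close> is a boundary point and \<open>other\<close> supplies a period whose rate is
      at most \<tau>.\<close>
    obtain \<psi> where \<psi>: "has_period s' \<psi>" "length \<psi> = length \<theta>" "sp (transition p \<psi>) \<le> \<tau>"
    proof (cases "s' = s")
      case True
      then show ?thesis using that[of \<theta>] per by (simp add: \<tau>_def)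
    next
      case False
      then have "boundary_point x" using boundary_point_if_two_reps[OF P' P] by blast
      then show ?thesis using that[of \<phi>] other[of s'] P' False symbolic_rep_iff \<tau>_def by blast
    qed
    have L': "length (butlast \<psi>) = L" using \<psi>(2) by (simp add: L_def)
    obtain N' where N': "0 < L" "\<And>n. N' \<le> n \<Longrightarrow> s' (n + L) = s' n"
      "\<And>k. map s' [N' + k * L..<Suc (N' + k * L + L)] = \<psi>"
      using has_periodE[OF \<psi>(1)] unfolding L' by blast
    show ?thesis
      using one_sided_measure_bound[OF P' sd[of N'], where \<theta> = \<psi> and t = t] N' \<psi>(3) t unfolding L' R_def by simp
  next
    case False
    then obtain \<delta> where \<delta>: "0 < \<delta>" "\<And>u. 0 < u \<Longrightarrow> u < \<delta> \<Longrightarrow> x + e * u \<notin> K" by blast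
    obtain C where C: "0 < C" "\<And>k. total_weight p (N + k * L) (\<Delta> (N + k * L)) \<le> C * t ^ k"
      using periodic_total_weight_bounds(3)[of x s \<Delta> p L N \<theta> t, OF P p_pos L N] t
      unfolding \<tau>_def by blast
    have "measure \<mu> ((\<lambda>u. x + e * u) ` {0..\<delta> / 2 * R ^ k}) \<le> C * t ^ k" for k
    proof -
      \<comment> \<open>The one-sided neighbourhood without \<open>x\<close> misses \<open>K\<close>
        and is null; the mass of \<open>x\<close> itself is bounded through the path of
        \<open>s\<close>.\<close>
      define A where "A = (if e = 1 then {x<..<x + \<delta>} else {x - \<delta><..<x})"
      have A: "A \<in> sets borel" by (simp add: A_def)
      have "y \<notin> K" if "y \<in> A" for y
      proof -
        have "0 < e * (y - x)" "e * (y - x) < \<delta>" "x + e * (e * (y - x)) = y"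
          using that e by (auto simp: A_def split: if_splits)
        then show ?thesis using \<delta>(2) by metis
      qed
      then have null: "measure \<mu> A = 0" using A by (intro mu_null_if_disjoint_K) auto
      have "R ^ k \<le> 1" using R by (intro power_le_one) auto
      then have "\<delta> / 2 * R ^ k \<le> \<delta> / 2 * 1" using \<delta>(1) by (intro mult_left_mono) auto
      then have "\<delta> / 2 * R ^ k < \<delta>" using \<delta>(1) by linarith
      then have "(\<lambda>u. x + e * u) ` {0..\<delta> / 2 * R ^ k} \<subseteq> {x} \<union> A" 
        using e by (auto simp: A_def le_less)
      then have "measure \<mu> ((\<lambda>u. x + e * u) ` {0..\<delta> / 2 * R ^ k}) \<le> measure \<mu> ({x} \<union> A)"
        using sets_mu A by (intro finite_measure_mono) auto
      also have "\<dots> \<le> measure \<mu> {x} + measure \<mu> A"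
        using sets_mu A by (intro measure_Un_le) auto
      also have "measure \<mu> {x} \<le> measure \<mu> (ivl (\<Delta> (N + k * L)))"
        using sets_mu net_pathD(2)[OF P] by (intro finite_measure_mono) (auto simp: ivl_def)
      also have "\<dots> \<le> C * t ^ k"
        using mu_net_interval_le[OF net_pathD(1)[OF P]] C(2) by (rule order_trans)
      finally show ?thesis using null by simp
    qed
    then show ?thesis using \<delta>(1) C(1)
      by (intro exI[of _ "\<delta> / 2"] conjI exI[of _ C]) auto
  qed
  have up: "\<exists>B>0. \<exists>C>0. \<forall>k. f (B * R ^ k) \<le> C * t ^ k" if t: "\<tau> < t" for t
  proof -
    obtain B1 C1 where 1: "0 < B1" "0 < C1"
      "\<And>k. measure \<mu> ((\<lambda>u. x + 1 * u) ` {0..B1 * R ^ k}) \<le> C1 * t ^ k"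
      using side[of 1 t] t by blast
    obtain B2 C2 where 2: "0 < B2" "0 < C2"
      "\<And>k. measure \<mu> ((\<lambda>u. x + (-1) * u) ` {0..B2 * R ^ k}) \<le> C2 * t ^ k"
      using side[of "-1" t] t by blast
    have i1: "(\<lambda>u. x + 1 * u) ` {0..b} = {x..x + b}" for b by simp
    have i2: "(\<lambda>u. x + (-1) * u) ` {0..b} = {x - b..x}" for b by (simp add: image_diff_atLeastAtMost)
    \<comment> \<open>The smaller of the two radii works on both sides, and the constants add
      up.\<close>
    have "f (min B1 B2 * R ^ k) \<le> (C1 + C2) * t ^ k" for k
    proof -
      define r where "r = min B1 B2 * R ^ k"
      have r: "r \<le> B1 * R ^ k" "r \<le> B2 * R ^ k"
        unfolding r_def using R by (auto intro!: mult_right_mono)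
      have "f r \<le> measure \<mu> ({x..x + B1 * R ^ k} \<union> {x - B2 * R ^ k..x})"
        unfolding f_def using sets_mu r by (intro finite_measure_mono) auto
      also have "\<dots> \<le> measure \<mu> {x..x + B1 * R ^ k} + measure \<mu> {x - B2 * R ^ k..x}"
        using sets_mu by (intro measure_Un_le) auto
      also have "\<dots> \<le> C1 * t ^ k + C2 * t ^ k"
        using 1(3)[of k] 2(3)[of k] unfolding i1 i2 by linarith
      finally show ?thesis unfolding r_def by (simp add: distrib_right)
    qed
    then show ?thesis using 1 2
      by (intro exI[of _ "min B1 B2"] conjI exI[of _ "C1 + C2"]) auto
  qed
  have "((\<lambda>r. ln (f r) / ln r) \<longlongrightarrow> ln \<tau> / ln R) (at_right 0)"
  proof (rule geometric_bounds_imp_log_ratio_tendsto[OF _ R _ _ c(1) low up])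
    show "f r \<le> f r'" if "r \<le> r'" for r r'
      unfolding f_def using that sets_mu by (intro finite_measure_mono) auto
    show "0 < \<tau>" unfolding \<tau>_def by (rule sp_transition_pos[OF P p_pos L N])
  qed (use rho_power_pos in auto)
  then show ?thesis
    using rho_pos by (simp add: has_local_dim_def f_def \<tau>_def R_def L_def ln_realpow)
qed

end

theorem proposition2p7:
  fixes m :: nat and \<rho> :: real and d :: "nat \<Rightarrow> real" and K :: "real set"
    and p :: "nat \<Rightarrow> real" and \<mu> :: "real measure" and x :: real
    and s :: "nat \<Rightarrow> char_vec" and \<theta> \<phi> :: "char_vec list"
  assumes "self_similar_measure m \<rho> d K p \<mu>"
    and "equicontractive_ifs.finite_type m \<rho> d"
    and "x \<in> K"
    and "equicontractive_ifs.symbolic_rep m \<rho> d K x s"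
    and "equicontractive_ifs.has_period m \<rho> d K s \<theta>"
    and "\<And>s'. equicontractive_ifs.boundary_point m \<rho> d K x \<Longrightarrow>
           equicontractive_ifs.symbolic_rep m \<rho> d K x s' \<Longrightarrow> s' \<noteq> s \<Longrightarrow>
           equicontractive_ifs.has_period m \<rho> d K s' \<phi> \<and> length \<phi> = length \<theta> \<and>
           sp (equicontractive_ifs.transition m \<rho> d K p \<theta>)
             \<ge> sp (equicontractive_ifs.transition m \<rho> d K p \<phi>)"
  shows "has_local_dim \<mu> x
           (ln (sp (equicontractive_ifs.transition m \<rho> d K p \<theta>)) /
            (real (length (butlast \<theta>)) * ln \<rho>))"
proof -
  interpret self_similar_measure m \<rho> d K p \<mu> by (rule assms(1))
  show ?thesis by (rule has_local_dim_periodic_point[OF assms(4,5,6)])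
qed

end
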